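(* For any sufficiently small $\delta > 0$, there exists a polynomial-time algorithm that, given a Correlation Clustering instance $(V, E^+ \cup E^-)$ with optimal value $\mathrm{opt}_0$, produces a preclustered instance $(\mathcal{K}, E_{\mathrm{adm}})$ such that (1) there exists a clustering that is good with respect to $(\mathcal{K}, E_{\mathrm{adm}})$ and whose cost is at most $(1+\delta)\,\mathrm{opt}_0$, and (2) $|E_{\mathrm{adm}}| \le O(\mathrm{opt}_0/\delta^{12})$.
   Context: Correlation Clustering: the input is a finite vertex set $V$ and a partition $E^+ \uplus E^- = \binom{V}{2}$ of all unordered pairs of distinct vertices. A clustering is a partition $\mathcal{C}$ of $V$; its cost is the number of pairs in $E^+$ whose endpoints lie in different clusters plus the number of pairs in $E^-$ whose endpoints lie in the same cluster. The optimal value is the minimum cost of a clustering. A preclustered instance for $(V,E^+\cup E^-)$ is a pair $(\mathcal{K}, E_{\mathrm{adm}})$ where $\mathcal{K}$ is a family of disjoint subsets of $V$ (not necessarily covering $V$), called atoms, and $E_{\mathrm{adm}} \subseteq \binom{V}{2}$ is a set of pairs (called admissible) such that for every $uv\in E_{\mathrm{adm}}$ at least one of $u,v$ is not in $\bigcup_{K\in\mathcal{K}}K$. A pair $uv$ with $u,v$ in the same $K\in\mathcal{K}$ is called atomic; a pair that is neither atomic nor admissible is called non-admissible. A clustering $\mathcal{C}$ of $V$ is good with respect to $(\mathcal{K}, E_{\mathrm{adm}})$ if the endpoints of every atomic pair are in the same cluster of $\mathcal{C}$ and the endpoints of every non-admissible pair are in different clusters of $\mathcal{C}$. *)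

theory Defs
  imports Complex_Main "HOL-Library.Disjoint_Sets" "HOL-Computational_Algebra.Polynomial"
begin

section \<open>Correlation Clustering\<close>

definition pairs :: "'a set \<Rightarrow> 'a set set" where
  "pairs V = {{u, v} | u v. u \<in> V \<and> v \<in> V \<and> u \<noteq> v}"

definition cc_instance :: "'a set \<Rightarrow> 'a set set \<Rightarrow> 'a set set \<Rightarrow> bool" where
  "cc_instance V Ep Em \<longleftrightarrow> finite V \<and> Ep \<union> Em = pairs V \<and> Ep \<inter> Em = {}"

definition together :: "'a set set \<Rightarrow> 'a set \<Rightarrow> bool" where
  "together \<C> e \<longleftrightarrow> (\<exists>B\<in>\<C>. e \<subseteq> B)"

definition cost :: "'a set set \<Rightarrow> 'a set set \<Rightarrow> 'a set set \<Rightarrow> nat" where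
  "cost Ep Em \<C> = card {e \<in> Ep. \<not> together \<C> e} + card {e \<in> Em. together \<C> e}"

definition opt :: "'a set \<Rightarrow> 'a set set \<Rightarrow> 'a set set \<Rightarrow> nat" where
  "opt V Ep Em = Min (cost Ep Em ` {\<C>. partition_on V \<C>})"


section \<open>Preclustered instances\<close>

definition preclustered :: "'a set \<Rightarrow> 'a set set \<Rightarrow> 'a set set \<Rightarrow> bool" where
  "preclustered V \<K> Eadm \<longleftrightarrow>
     (\<forall>K\<in>\<K>. K \<subseteq> V) \<and> disjoint \<K> \<and> Eadm \<subseteq> pairs V \<and>
     (\<forall>u v. {u, v} \<in> Eadm \<longrightarrow> u \<notin> \<Union>\<K> \<or> v \<notin> \<Union>\<K>)"

definition atomic_pairs :: "'a set \<Rightarrow> 'a set set \<Rightarrow> 'a set set" where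
  "atomic_pairs V \<K> = {e \<in> pairs V. \<exists>K\<in>\<K>. e \<subseteq> K}"

definition nonadmissible_pairs :: "'a set \<Rightarrow> 'a set set \<Rightarrow> 'a set set \<Rightarrow> 'a set set" where
  "nonadmissible_pairs V \<K> Eadm = pairs V - atomic_pairs V \<K> - Eadm"

definition good_clustering :: "'a set \<Rightarrow> 'a set set \<Rightarrow> 'a set set \<Rightarrow> 'a set set \<Rightarrow> bool" where
  "good_clustering V \<K> Eadm \<C> \<longleftrightarrow>
     partition_on V \<C> \<and>
     (\<forall>e\<in>atomic_pairs V \<K>. together \<C> e) \<and>
     (\<forall>e\<in>nonadmissible_pairs V \<K> Eadm. \<not> together \<C> e)"


section \<open>Algorithms\<close>

text \<open>
  Algorithms are structured programs for a random access machine with addition and truncated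
  subtraction on natural numbers, in the unit-cost measure. There is deliberately no
  multiplication or shift: in \<open>t\<close> steps, numbers grow by at most \<open>O(t)\<close> bits, so running time
  polynomial in this model is the same as polynomial time on Turing machines.
  A state consists of registers and of arrays with indirect addressing; a program mentions only
  finitely many registers and (constant) array names. Registers, array names, array indices
  and the stored values are natural numbers.
\<close>

datatype com =
    Skip
  | Const nat nat
  | Add nat nat nat
  | Sub nat nat nat
  | Load nat nat nat
  | Store nat nat nat
  | Seq com com
  | If nat com com
  | While nat com

type_synonym state = "(nat \<Rightarrow> nat) \<times> (nat \<Rightarrow> nat \<Rightarrow> nat)"

text \<open>
  \<open>exec c s t s'\<close>: started in \<open>s\<close>, the program \<open>c\<close> halts after exactly \<open>t\<close> steps in \<open>s'\<close>.
  Conditions of \<open>If\<close> and \<open>While\<close> test a register for being nonzero.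
\<close>

inductive exec :: "com \<Rightarrow> state \<Rightarrow> nat \<Rightarrow> state \<Rightarrow> bool" where
  Skip: "exec Skip s 1 s"
| Const: "exec (Const x k) (r, m) 1 (r(x := k), m)"
| Add: "exec (Add x y z) (r, m) 1 (r(x := r y + r z), m)"
| Sub: "exec (Sub x y z) (r, m) 1 (r(x := r y - r z), m)"
| Load: "exec (Load x a y) (r, m) 1 (r(x := m a (r y)), m)"
| Store: "exec (Store a y x) (r, m) 1 (r, m(a := (m a)(r y := r x)))"
| Seq: "exec c s t s' \<Longrightarrow> exec d s' t' s'' \<Longrightarrow> exec (Seq c d) s (t + t') s''"
| IfTrue: "fst s x \<noteq> 0 \<Longrightarrow> exec c s t s' \<Longrightarrow> exec (If x c d) s (1 + t) s'"
| IfFalse: "fst s x = 0 \<Longrightarrow> exec d s t s' \<Longrightarrow> exec (If x c d) s (1 + t) s'"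
| WhileFalse: "fst s x = 0 \<Longrightarrow> exec (While x c) s 1 s"
| WhileTrue: "fst s x \<noteq> 0 \<Longrightarrow> exec c s t s' \<Longrightarrow> exec (While x c) s' t' s'' \<Longrightarrow>
    exec (While x c) s (1 + t + t') s''"

lemma exec_While_iff:
  "exec (While x c) s t s' \<longleftrightarrow>
     (if fst s x = 0 then t = 1 \<and> s' = s
      else \<exists>t1 s1 t2. t = 1 + t1 + t2 \<and> exec c s t1 s1 \<and> exec (While x c) s1 t2 s')"
  by (subst exec.simps) auto

lemma exec_simps:
  "exec Skip s t s' \<longleftrightarrow> t = 1 \<and> s' = s"
  "exec (Const x k) s t s' \<longleftrightarrow> t = 1 \<and> s' = ((fst s)(x := k), snd s)"
  "exec (Add x y z) s t s' \<longleftrightarrow> t = 1 \<and> s' = ((fst s)(x := fst s y + fst s z), snd s)"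
  "exec (Sub x y z) s t s' \<longleftrightarrow> t = 1 \<and> s' = ((fst s)(x := fst s y - fst s z), snd s)"
  "exec (Load x a y) s t s' \<longleftrightarrow> t = 1 \<and> s' = ((fst s)(x := snd s a (fst s y)), snd s)"
  "exec (Store a y x) s t s' \<longleftrightarrow>
     t = 1 \<and> s' = (fst s, (snd s)(a := (snd s a)(fst s y := fst s x)))"
  "exec (Seq c d) s t s' \<longleftrightarrow> (\<exists>t1 s1 t2. t = t1 + t2 \<and> exec c s t1 s1 \<and> exec d s1 t2 s')"
  "exec (If x c d) s t s' \<longleftrightarrow>
     (\<exists>t1. t = 1 + t1 \<and> (if fst s x \<noteq> 0 then exec c s t1 s' else exec d s t1 s'))"
  by (subst exec.simps; cases s; auto)+

lemma exec_deterministic: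
  "exec c s t s' \<Longrightarrow> exec c s u s'' \<Longrightarrow> u = t \<and> s'' = s'"
proof (induction arbitrary: u s'' rule: exec.induct)
  case (WhileFalse s x c)
  then show ?case by (simp add: exec_While_iff[of x c s])
next
  case (WhileTrue s x c t s1 t' s2)
  from WhileTrue.prems WhileTrue.hyps obtain v s3 v'
    where "u = 1 + v + v'" "exec c s v s3" "exec (While x c) s3 v' s''"
    unfolding exec_While_iff[of x c s u] by auto
  with WhileTrue.IH(1)[of v s3] WhileTrue.IH(2)[of v' s''] show ?case by simp
next
  case (Seq c s t s1 d t' s2)
  from Seq.prems obtain v s3 v' where "u = v + v'" "exec c s v s3" "exec d s3 v' s''"
    unfolding exec_simps by blast
  with Seq.IH(1)[of v s3] Seq.IH(2)[of v' s''] show ?case by simp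
next
  case (IfTrue s x c t s1 d)
  from IfTrue.prems IfTrue.hyps obtain v where "u = 1 + v" "exec c s v s''"
    unfolding exec_simps by auto
  with IfTrue.IH[of v s''] show ?case by simp
next
  case (IfFalse s x d t s1 c)
  from IfFalse.prems IfFalse.hyps obtain v where "u = 1 + v" "exec d s v s''"
    unfolding exec_simps by auto
  with IfFalse.IH[of v s''] show ?case by simp
qed (simp_all add: exec_simps)


section \<open>Input and output encoding\<close>

text \<open>
  The vertices are presented to the machine as \<open>0, \<dots>, n - 1\<close> by means of an arbitrary
  enumeration \<open>vs\<close> of \<open>V\<close>. Initially register 0 holds \<open>n\<close>, array 0 holds the \<open>n \<times> n\<close>
  adjacency matrix of \<open>E\<^sup>+\<close> in row-major order, and everything else is 0; \<open>E\<^sup>-\<close> is the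
  complement.
\<close>

definition input_state :: "'a list \<Rightarrow> 'a set set \<Rightarrow> state" where
  "input_state vs Ep = (let n = length vs in
     (\<lambda>x. if x = 0 then n else 0,
      \<lambda>a k. if a = 0 \<and> k < n * n \<and> {vs ! (k div n), vs ! (k mod n)} \<in> Ep then 1 else 0))"

text \<open>
  In the final state, array 1 holds for each vertex index 0 if the vertex is in no atom, and
  otherwise a positive label that identifies its atom; array 2 holds in row-major order a matrix
  of which the entries above the diagonal indicate the admissible pairs.
\<close>

definition output_atoms :: "'a list \<Rightarrow> state \<Rightarrow> 'a set set" where
  "output_atoms vs s = (let lab = snd s 1; n = length vs in
     {{vs ! i | i. i < n \<and> lab i = lab j} | j. j < n \<and> lab j \<noteq> 0})"

definition output_admissible :: "'a list \<Rightarrow> state \<Rightarrow> 'a set set" where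
  "output_admissible vs s = (let n = length vs in
     {{vs ! i, vs ! j} | i j. i < j \<and> j < n \<and> snd s 2 (i * n + j) \<noteq> 0})"

end

theory Submission
  imports Defs
begin

text \<open>
  Clusterings are labellings \<open>f\<close> of the vertices. With closed neighbourhoods \<open>nb u\<close>, twice the cost of
  \<open>f\<close> is the sum over \<open>u\<close> of the size of the symmetric difference of \<open>nb u\<close> and the cluster of \<open>u\<close>.

  Call a set \<open>K\<close> an atom if \<open>nb u\<close> differs from \<open>K\<close> in at most \<open>|K| / 16\<close> vertices for all
  \<open>u \<in> K\<close>. By local optimality, every optimal clustering keeps an atom \<open>K\<close> inside one cluster, which
  has at most \<open>|K| / 8\<close> further vertices; hence two atoms lie in the same cluster iff they intersect. No
  approximation algorithm is needed to find atoms: as candidates it suffices to take, for each \<open>u\<close>, the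
  set of all \<open>v\<close> whose neighbourhood is close to that of \<open>u\<close>. A vertex in no such candidate atom
  has degree bounded by its own share of the optimal cost, or else most of its cluster is badly
  clustered, so that the degrees of the uncovered vertices sum up to \<open>O(opt)\<close>.

  For the admissible pairs, remove from an optimal clustering the vertices of degree more than \<open>L\<close> times
  the size of their cluster, and all uncovered vertices from clusters with too many of those; this costs
  a factor of \<open>1 + O(1/L)\<close>. Since no cut of an optimal cluster is sparse, any two remaining vertices
  of a cluster have many common neighbours or are connected by many paths of length 3, through
  vertices of comparable degree. Pairs with this property are declared admissible, and a vertex of degree
  \<open>d\<close> has at most \<open>O(L\<^sup>4 d)\<close> partners. With \<open>L = O(1/\<delta>)\<close> this even gives the exponent 4.
\<close>

section \<open>Compiling arithmetic expressions\<close>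

definition runs :: "com \<Rightarrow> state \<Rightarrow> nat \<Rightarrow> state \<Rightarrow> bool" where
  "runs c s T s' \<longleftrightarrow> (\<exists>t\<le>T. exec c s t s')"

lemma runs_mono: "runs c s T s' \<Longrightarrow> T \<le> U \<Longrightarrow> runs c s U s'"
  unfolding runs_def using le_trans by blast

lemma runs_Seq: "runs c s T s' \<Longrightarrow> runs d s' U s'' \<Longrightarrow> runs (Seq c d) s (T + U) s''"
  unfolding runs_def by (meson add_mono exec.Seq)

lemma runs_Const: "runs (Const x k) (r, m) 1 (r(x := k), m)"
  and runs_Add: "runs (Add x y z) (r, m) 1 (r(x := r y + r z), m)"
  and runs_Sub: "runs (Sub x y z) (r, m) 1 (r(x := r y - r z), m)"
  and runs_Load: "runs (Load x a y) (r, m) 1 (r(x := m a (r y)), m)"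
  and runs_Store: "runs (Store a y x) (r, m) 1 (r, m(a := (m a)(r y := r x)))"
  unfolding runs_def by (rule exI[of _ 1]; simp add: exec_simps)+

lemma runs_WhileFalse: "fst s x = 0 \<Longrightarrow> runs (While x c) s 1 s"
  unfolding runs_def by (rule exI[of _ 1]) (simp add: exec_While_iff)

lemma runs_WhileTrue:
  "fst s x \<noteq> 0 \<Longrightarrow> runs c s T s' \<Longrightarrow> runs (While x c) s' U s'' \<Longrightarrow> runs (While x c) s (1 + T + U) s''"
  unfolding runs_def by (meson add_mono add_le_mono le_refl exec.WhileTrue)

text \<open>\<open>While\<close> only tests for nonzero, so \<open>t\<close> holds the number of
  passes left. It is recomputed from \<open>x\<close> and register 0 after every pass; the body may
  therefore use \<open>t\<close> as scratch space.\<close>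

definition for_loop :: "nat \<Rightarrow> nat \<Rightarrow> com \<Rightarrow> com" where
  "for_loop x t c = Seq (Const x 0) (Seq (Sub t 0 x)
     (While t (Seq c (Seq (Const t 1) (Seq (Add x x t) (Sub t 0 x))))))"

lemma for_loop_runs:
  assumes distinct: "t \<noteq> 0" "x \<noteq> 0" "t \<noteq> x" and n: "r 0 = n"
    and init: "I 0 (r(x := 0, t := n)) m"
    and step: "\<And>k r m. k < n \<Longrightarrow> I k r m \<Longrightarrow> r x = k \<Longrightarrow> r 0 = n \<Longrightarrow>
      \<exists>r' m'. runs c (r, m) T (r', m') \<and> r' x = k \<and> r' 0 = n \<and>
        I (Suc k) (r'(x := Suc k, t := n - Suc k)) m'"
  shows "\<exists>r' m'. runs (for_loop x t c) (r, m) (3 + n * (T + 4)) (r', m') \<and> r' 0 = n \<and> I n r' m'"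
proof -
  let ?b = "Seq c (Seq (Const t 1) (Seq (Add x x t) (Sub t 0 x)))"
  have loop: "\<exists>r' m'. runs (While t ?b) (r, m) (1 + (n - k) * (T + 4)) (r', m') \<and> r' 0 = n \<and> I n r' m'"
    if "k \<le> n" "I k r m" "r x = k" "r 0 = n" "r t = n - k" for k r m
    using that
  proof (induction "n - k" arbitrary: k r m)
    case 0
    then show ?case using runs_WhileFalse[of "(r, m)" t] by fastforce
  next
    case (Suc j)
    from Suc have k: "k < n" by simp
    from step[OF k Suc.prems(2,3,4)] obtain r1 m1
      where s1: "runs c (r, m) T (r1, m1)" "r1 x = k" "r1 0 = n"
        "I (Suc k) (r1(x := Suc k, t := n - Suc k)) m1" by blast
    let ?r2 = "r1(x := Suc k, t := n - Suc k)"
    have "runs (Seq (Const t 1) (Seq (Add x x t) (Sub t 0 x))) (r1, m1) 3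
       (r1(t := 1, x := k + 1, t := n - Suc k), m1)"
      using runs_Seq[OF runs_Const[of t 1 r1 m1] runs_Seq[OF runs_Add[of x x t] runs_Sub[of t 0 x]]]
        s1 distinct by (simp add: numeral_3_eq_3)
    moreover have "r1(t := 1, x := k + 1, t := n - Suc k) = ?r2" using distinct by auto
    ultimately have b: "runs ?b (r, m) (T + 3) (?r2, m1)" using runs_Seq[OF s1(1)] by metis
    have "j = n - Suc k" using Suc.hyps(2) by simp
    from Suc.hyps(1)[OF this _ s1(4)] obtain r' m' where
      w: "runs (While t ?b) (?r2, m1) (1 + (n - Suc k) * (T + 4)) (r', m')" "r' 0 = n" "I n r' m'"
      using k distinct s1(3) by auto
    have "runs (While t ?b) (r, m) (1 + (T + 3) + (1 + (n - Suc k) * (T + 4))) (r', m')"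
      using runs_WhileTrue[OF _ b w(1)] Suc.prems(5) k by simp
    moreover have "n - k = Suc (n - Suc k)" using k by simp
    ultimately have "runs (While t ?b) (r, m) (1 + (n - k) * (T + 4)) (r', m')"
      by (elim runs_mono) (simp add: algebra_simps)
    with w show ?case by blast
  qed
  from loop[of 0, OF _ init] obtain r' m'
    where w: "runs (While t ?b) (r(x := 0, t := n), m) (1 + n * (T + 4)) (r', m')" "r' 0 = n" "I n r' m'"
    using distinct n by auto
  have "runs (for_loop x t c) (r, m) (1 + (1 + (1 + n * (T + 4)))) (r', m')"
    unfolding for_loop_def
    using runs_Seq[OF runs_Const[of x 0 r m] runs_Seq[OF runs_Sub[of t 0 x "r(x := 0)" m]]] w(1)
      distinct n by simp
  then show ?thesis using w by (intro exI[of _ r'] exI[of _ m']) (auto simp: numeral_3_eq_3)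
qed

text \<open>With sums over all \<open>k < n\<close> as the only form of iteration, every fixed
  expression takes polynomial time, yet counting and quantification over vertices are
  expressible.\<close>

datatype aexp = Var nat | Num nat | Plus aexp aexp | Minus aexp aexp | Inp aexp | Sum nat aexp

primrec eval :: "nat \<Rightarrow> (nat \<Rightarrow> nat) \<Rightarrow> aexp \<Rightarrow> (nat \<Rightarrow> nat) \<Rightarrow> nat" where
  "eval n a (Var x) \<rho> = \<rho> x"
| "eval n a (Num k) \<rho> = k"
| "eval n a (Plus e f) \<rho> = eval n a e \<rho> + eval n a f \<rho>"
| "eval n a (Minus e f) \<rho> = eval n a e \<rho> - eval n a f \<rho>"
| "eval n a (Inp e) \<rho> = a (eval n a e \<rho>)"
| "eval n a (Sum x e) \<rho> = (\<Sum>k<n. eval n a e (\<rho>(x := k)))"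

text \<open>Register 0 keeps the input size, variable \<open>x\<close> lives in register \<open>2 * x + 2\<close>, and the odd
  registers from \<open>2 * b + 1\<close> on are scratch space, the first of them receiving the value.
  \<open>Sum\<close> restores its bound variable, so that no capture conditions arise.\<close>

primrec compile :: "aexp \<Rightarrow> nat \<Rightarrow> com" where
  "compile (Var x) b = Seq (Const (2 * b + 1) 0) (Add (2 * b + 1) (2 * b + 1) (2 * x + 2))"
| "compile (Num k) b = Const (2 * b + 1) k"
| "compile (Plus e f) b = Seq (compile e b) (Seq (compile f (b + 1))
     (Add (2 * b + 1) (2 * b + 1) (2 * b + 3)))"
| "compile (Minus e f) b = Seq (compile e b) (Seq (compile f (b + 1))
     (Sub (2 * b + 1) (2 * b + 1) (2 * b + 3)))"
| "compile (Inp e) b = Seq (compile e b) (Load (2 * b + 1) 0 (2 * b + 1))"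
| "compile (Sum x e) b = Seq (Const (2 * b + 1) 0) (Seq (Const (2 * b + 3) 0)
     (Seq (Add (2 * b + 3) (2 * b + 3) (2 * x + 2))
     (Seq (for_loop (2 * x + 2) (2 * b + 5)
       (Seq (compile e (b + 3)) (Add (2 * b + 1) (2 * b + 1) (2 * b + 7))))
     (Seq (Const (2 * x + 2) 0) (Add (2 * x + 2) (2 * x + 2) (2 * b + 3))))))"

text \<open>For \<open>Sum\<close>, the 8 covers clearing the accumulator, saving and restoring the
  bound variable, and the loop overhead outside the passes; the 5 is the overhead of one pass plus
  the addition to the accumulator.\<close>

primrec time :: "aexp \<Rightarrow> nat poly" where
  "time (Var x) = [:2:]"
| "time (Num k) = [:1:]"
| "time (Plus e f) = time e + time f + [:1:]"
| "time (Minus e f) = time e + time f + [:1:]"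
| "time (Inp e) = time e + [:1:]"
| "time (Sum x e) = [:8:] + [:0, 1:] * (time e + [:5:])"

text \<open>Preservation of the even registers and of the odd ones below \<open>2 * b + 1\<close>
  carries the induction: the second operand, compiled with \<open>b + 1\<close>, disturbs neither
  the variables nor the value of the first.\<close>

lemma compile_runs:
  "\<exists>r'. runs (compile e b) (r, m) (poly (time e) (r 0)) (r', m) \<and>
     r' (2 * b + 1) = eval (r 0) (m 0) e (\<lambda>x. r (2 * x + 2)) \<and>
     (\<forall>i. even i \<or> i < 2 * b + 1 \<longrightarrow> r' i = r i)"
proof (induction e arbitrary: b r)
  case (Var x)
  let ?r = "r(2 * b + 1 := r (2 * x + 2))"
  have ne: "2 * b + 1 \<noteq> 2 * x + 2" by presburger
  then have "r(2 * b + 1 := 0, 2 * b + 1 := (r(2 * b + 1 := 0)) (2 * b + 1) + (r(2 * b + 1 := 0)) (2 * x + 2)) = ?r"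
    by simp
  with runs_Seq[OF runs_Const[of "2 * b + 1" 0 r m] runs_Add[of "2 * b + 1" "2 * b + 1" "2 * x + 2"]]
  have "runs (compile (Var x) b) (r, m) 2 (?r, m)" by (simp add: numeral_2_eq_2)
  then have "runs (compile (Var x) b) (r, m) (poly (time (Var x)) (r 0)) (?r, m)" by simp
  moreover have "?r (2 * b + 1) = eval (r 0) (m 0) (Var x) (\<lambda>x. r (2 * x + 2))" by simp
  moreover have "\<forall>i. even i \<or> i < 2 * b + 1 \<longrightarrow> ?r i = r i" by auto
  ultimately show ?case by blast
next
  case (Num k)
  show ?case
  proof (intro exI conjI)
    show "runs (compile (Num k) b) (r, m) (poly (time (Num k)) (r 0)) (r(2 * b + 1 := k), m)"
      using runs_Const[of "2 * b + 1" k r m] by simp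
  qed auto
next
  case (Plus e f)
  from Plus.IH(1)[of b r] obtain r1 where r1: "runs (compile e b) (r, m) (poly (time e) (r 0)) (r1, m)"
    "r1 (2 * b + 1) = eval (r 0) (m 0) e (\<lambda>x. r (2 * x + 2))"
    "\<forall>i. even i \<or> i < 2 * b + 1 \<longrightarrow> r1 i = r i" by blast
  from Plus.IH(2)[of "b + 1" r1] obtain r2 where r2:
    "runs (compile f (b + 1)) (r1, m) (poly (time f) (r1 0)) (r2, m)"
    "r2 (2 * b + 3) = eval (r1 0) (m 0) f (\<lambda>x. r1 (2 * x + 2))"
    "\<forall>i. even i \<or> i < 2 * b + 3 \<longrightarrow> r2 i = r1 i" by (auto simp: numeral_3_eq_3)
  have "r2 (2 * b + 1) = eval (r 0) (m 0) e (\<lambda>x. r (2 * x + 2))"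
    "r2 (2 * b + 3) = eval (r 0) (m 0) f (\<lambda>x. r (2 * x + 2))" using r1 r2 by auto
  note v = this
  show ?case
  proof (intro exI conjI)
    show "runs (compile (Plus e f) b) (r, m) (poly (time (Plus e f)) (r 0))
       (r2(2 * b + 1 := r2 (2 * b + 1) + r2 (2 * b + 3)), m)"
      using runs_Seq[OF r1(1) runs_Seq[OF r2(1) runs_Add[of "2 * b + 1" "2 * b + 1" "2 * b + 3"]]] r1(3)
      by (simp add: add.assoc)
  qed (use v r1 r2 in auto)
next
  case (Minus e f)
  from Minus.IH(1)[of b r] obtain r1 where r1: "runs (compile e b) (r, m) (poly (time e) (r 0)) (r1, m)"
    "r1 (2 * b + 1) = eval (r 0) (m 0) e (\<lambda>x. r (2 * x + 2))"
    "\<forall>i. even i \<or> i < 2 * b + 1 \<longrightarrow> r1 i = r i" by blast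
  from Minus.IH(2)[of "b + 1" r1] obtain r2 where r2:
    "runs (compile f (b + 1)) (r1, m) (poly (time f) (r1 0)) (r2, m)"
    "r2 (2 * b + 3) = eval (r1 0) (m 0) f (\<lambda>x. r1 (2 * x + 2))"
    "\<forall>i. even i \<or> i < 2 * b + 3 \<longrightarrow> r2 i = r1 i" by (auto simp: numeral_3_eq_3)
  have "r2 (2 * b + 1) = eval (r 0) (m 0) e (\<lambda>x. r (2 * x + 2))"
    "r2 (2 * b + 3) = eval (r 0) (m 0) f (\<lambda>x. r (2 * x + 2))" using r1 r2 by auto
  note v = this
  show ?case
  proof (intro exI conjI)
    show "runs (compile (Minus e f) b) (r, m) (poly (time (Minus e f)) (r 0))
       (r2(2 * b + 1 := r2 (2 * b + 1) - r2 (2 * b + 3)), m)"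
      using runs_Seq[OF r1(1) runs_Seq[OF r2(1) runs_Sub[of "2 * b + 1" "2 * b + 1" "2 * b + 3"]]] r1(3)
      by (simp add: add.assoc)
  qed (use v r1 r2 in auto)
next
  case (Inp e)
  from Inp.IH[of b r] obtain r1 where r1: "runs (compile e b) (r, m) (poly (time e) (r 0)) (r1, m)"
    "r1 (2 * b + 1) = eval (r 0) (m 0) e (\<lambda>x. r (2 * x + 2))"
    "\<forall>i. even i \<or> i < 2 * b + 1 \<longrightarrow> r1 i = r i" by blast
  note r1 = this
  show ?case
  proof (intro exI conjI)
    show "runs (compile (Inp e) b) (r, m) (poly (time (Inp e)) (r 0)) (r1(2 * b + 1 := m 0 (r1 (2 * b + 1))), m)"
      using runs_Seq[OF r1(1) runs_Load[of "2 * b + 1" 0 "2 * b + 1"]] by simp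
  qed (use r1 in auto)
next
  case (Sum x e)
  let ?X = "2 * x + 2" and ?n = "r 0" and ?\<rho> = "\<lambda>x. r (2 * x + 2)"
  let ?body = "Seq (compile e (b + 3)) (Add (2 * b + 1) (2 * b + 1) (2 * b + 7))"
  let ?r0 = "r(2 * b + 1 := 0, 2 * b + 3 := r ?X)"
  \<comment> \<open>Register \<open>2 * b + 1\<close> accumulates the sum and
    \<open>2 * b + 3\<close> keeps the old value of the bound variable, whose own register serves as
    the loop counter and is therefore exempt from preservation.\<close>
  define I where "I = (\<lambda>k r' m'. m' = m \<and> r' (2 * b + 1) = (\<Sum>j<k. eval ?n (m 0) e (?\<rho>(x := j))) \<and>
      r' (2 * b + 3) = r ?X \<and> (\<forall>i. i \<noteq> ?X \<and> (even i \<or> i < 2 * b + 1) \<longrightarrow> r' i = r i))"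
  have "\<exists>r' m'. runs (for_loop ?X (2 * b + 5) ?body) (?r0, m) (3 + ?n * ((poly (time e) ?n + 1) + 4)) (r', m')
     \<and> r' 0 = ?n \<and> I ?n r' m'"
  proof (rule for_loop_runs)
    show "I 0 (?r0(?X := 0, 2 * b + 5 := ?n)) m" unfolding I_def
      by (auto; presburger)
  next
    fix k r1 m1
    assume k: "k < ?n" "I k r1 m1" "r1 ?X = k" "r1 0 = ?n"
    from Sum.IH[of "b + 3" r1] obtain r2 where r2:
      "runs (compile e (b + 3)) (r1, m) (poly (time e) (r1 0)) (r2, m)"
      "r2 (2 * b + 7) = eval (r1 0) (m 0) e (\<lambda>x. r1 (2 * x + 2))"
      "\<forall>i. even i \<or> i < 2 * b + 7 \<longrightarrow> r2 i = r1 i" by (auto simp: eval_nat_numeral)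
    have m1: "m1 = m" using k by (simp add: I_def)
    have "(\<lambda>x. r1 (2 * x + 2)) = ?\<rho>(x := k)" using k by (auto simp: I_def fun_eq_iff)
    with r2 k have v: "r2 (2 * b + 7) = eval ?n (m 0) e (?\<rho>(x := k))" by simp
    let ?r3 = "r2(2 * b + 1 := r2 (2 * b + 1) + r2 (2 * b + 7))"
    have "runs ?body (r1, m1) (poly (time e) ?n + 1) (?r3, m)"
      using runs_Seq[OF r2(1) runs_Add] m1 k(4) by simp
    moreover have "?r3 ?X = k \<and> ?r3 0 = ?n"
    proof -
      have "r2 ?X = r1 ?X" "r2 0 = r1 0" by (rule r2(3)[rule_format], simp)+
      moreover have "2 * b + 1 \<noteq> ?X" by presburger
      ultimately show ?thesis using k(3,4) by simp
    qed
    moreover have "I (Suc k) (?r3(?X := Suc k, 2 * b + 5 := ?n - Suc k)) m"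
    proof -
      have "r2 (2 * b + 1) = (\<Sum>j<k. eval ?n (m 0) e (?\<rho>(x := j)))" "r2 (2 * b + 3) = r ?X"
        using r2(3)[rule_format, of "2 * b + 1"] r2(3)[rule_format, of "2 * b + 3"] k(2)
        by (simp_all add: I_def)
      moreover have "2 * b + 1 \<noteq> ?X" "2 * b + 3 \<noteq> ?X" "2 * b + 5 \<noteq> ?X" by presburger+
      moreover have "even i \<Longrightarrow> i \<noteq> 2 * b + 5" "even i \<Longrightarrow> i \<noteq> 2 * b + 1" for i by presburger+
      moreover have "r2 i = r i" if "i \<noteq> ?X" "even i \<or> i < 2 * b + 1" for i
      proof -
        have "even i \<or> i < 2 * b + 7" using that(2) by auto
        then have "r2 i = r1 i" using r2(3) by blast
        then show ?thesis using k(2) that by (simp add: I_def)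
      qed
      ultimately show ?thesis
        using v unfolding I_def by simp
    qed
    ultimately show "\<exists>r' m'. runs ?body (r1, m1) (poly (time e) ?n + 1) (r', m') \<and> r' ?X = k \<and>
       r' 0 = ?n \<and> I (Suc k) (r'(?X := Suc k, 2 * b + 5 := ?n - Suc k)) m'" by blast
  qed (auto; presburger)+
  then obtain r1 where r1: "runs (for_loop ?X (2 * b + 5) ?body) (?r0, m)
      (3 + ?n * (poly (time e) ?n + 5)) (r1, m)" "r1 0 = ?n" "I ?n r1 m"
    by (auto simp: I_def ac_simps)
  have "r1 (2 * b + 3) = r ?X"
    "r1 (2 * b + 1) = eval ?n (m 0) (Sum x e) ?\<rho>"
    "\<forall>i. i \<noteq> ?X \<and> (even i \<or> i < 2 * b + 1) \<longrightarrow> r1 i = r i"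
    using r1(3) by (simp_all add: I_def)
  note r1 = r1 this
  let ?r2 = "r1(?X := r ?X)"
  have fin: "runs (Seq (Const ?X 0) (Add ?X ?X (2 * b + 3))) (r1, m) 2 (?r2, m)"
  proof -
    have "2 * b + 3 \<noteq> ?X" by presburger
    then have eq: "(r1(?X := 0)) ?X + (r1(?X := 0)) (2 * b + 3) = r ?X"
      using r1(4) by simp
    have "runs (Seq (Const ?X 0) (Add ?X ?X (2 * b + 3))) (r1, m) (1 + 1)
        (r1(?X := 0, ?X := (r1(?X := 0)) ?X + (r1(?X := 0)) (2 * b + 3)), m)"
      by (rule runs_Seq[OF runs_Const runs_Add])
    then show ?thesis by (simp only: eq fun_upd_upd one_add_one)
  qed
  have start: "runs (Const (2 * b + 1) 0) (r, m) 1 (r(2 * b + 1 := 0), m)"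
    "runs (Const (2 * b + 3) 0) (r(2 * b + 1 := 0), m) 1 (r(2 * b + 1 := 0, 2 * b + 3 := 0), m)"
    "runs (Add (2 * b + 3) (2 * b + 3) ?X) (r(2 * b + 1 := 0, 2 * b + 3 := 0), m) 1 (?r0, m)"
  proof -
    have "?X \<noteq> 2 * b + 1" "?X \<noteq> 2 * b + 3" by presburger+
    then have "r(2 * b + 1 := 0, 2 * b + 3 := 0,
       2 * b + 3 := (r(2 * b + 1 := 0, 2 * b + 3 := 0)) (2 * b + 3) + (r(2 * b + 1 := 0, 2 * b + 3 := 0)) ?X)
       = ?r0" by auto
    then show "runs (Add (2 * b + 3) (2 * b + 3) ?X) (r(2 * b + 1 := 0, 2 * b + 3 := 0), m) 1 (?r0, m)"
      using runs_Add[of "2 * b + 3" "2 * b + 3" ?X "r(2 * b + 1 := 0, 2 * b + 3 := 0)" m] by metis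
  qed (rule runs_Const)+
  have "runs (compile (Sum x e) b) (r, m)
     (1 + (1 + (1 + (3 + ?n * (poly (time e) ?n + 5) + 2)))) (?r2, m)"
    unfolding compile.simps by (intro runs_Seq[OF start(1)] runs_Seq[OF start(2)] runs_Seq[OF start(3)]
        runs_Seq[OF r1(1)] fin)
  then have "runs (compile (Sum x e) b) (r, m) (poly (time (Sum x e)) (r 0)) (?r2, m)"
    by (simp add: algebra_simps)
  moreover have "2 * b + 1 \<noteq> ?X" by presburger
  then have "?r2 (2 * b + 1) = eval ?n (m 0) (Sum x e) ?\<rho>" using r1(5) by simp
  moreover have "\<forall>i. even i \<or> i < 2 * b + 1 \<longrightarrow> ?r2 i = r i" using r1(6) by simp
  ultimately show ?case by blast
qed

text \<open>The loop counters, registers 2 and 4, are variables 0 and 1. Summing variable 0 over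
  \<open>n\<close> values yields the row offset, so the index \<open>i * n + j\<close> needs no
  multiplication. Both loops can share register 1 with the compiled code because
  \<open>for_loop\<close> recomputes it. The atom label is rewritten for every column.\<close>

definition fill_tables :: "aexp \<Rightarrow> aexp \<Rightarrow> com" where
  "fill_tables e f = for_loop 2 1 (for_loop 4 1
     (Seq (compile e 0) (Seq (Store 1 2 1)
     (Seq (compile (Plus (Sum 2 (Var 0)) (Var 1)) 0) (Seq (compile f 1) (Store 2 1 3))))))"

lemma mult_add_div_mod:
  fixes i j n :: nat
  assumes "j < n"
  shows "(i * n + j) div n = i" "(i * n + j) mod n = j"
  using assms by auto

lemma mult_add_eq_iff:
  fixes i j n :: nat
  assumes "j < n" "j' < n"
  shows "i * n + j = i' * n + j' \<longleftrightarrow> i = i' \<and> j = j'"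
  using assms mult_add_div_mod by metis

lemma fill_tables_exec:
  assumes F: "\<And>\<rho>. \<rho> 0 < n \<Longrightarrow> eval n a e \<rho> = F (\<rho> 0)"
    and G: "\<And>\<rho>. \<rho> 0 < n \<Longrightarrow> \<rho> 1 < n \<Longrightarrow> eval n a f \<rho> = G (\<rho> 0) (\<rho> 1)"
    and r: "r 0 = n" and m: "m 0 = a"
  defines "p \<equiv> [:3:] + [:0, 1:] * ([:3:] + [:0, 1:] *
     (time e + (time (Plus (Sum 2 (Var 0)) (Var 1)) + time f) + [:6:]) + [:4:])"
  shows "\<exists>t s. exec (fill_tables e f) (r, m) t s \<and> t \<le> poly p n \<and>
    (\<forall>i<n. snd s 1 i = F i) \<and> (\<forall>i<n. \<forall>j<n. snd s 2 (i * n + j) = G i j)"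
proof -
  let ?body = "Seq (compile e 0) (Seq (Store 1 2 1)
     (Seq (compile (Plus (Sum 2 (Var 0)) (Var 1)) 0) (Seq (compile f 1) (Store 2 1 3))))"
  let ?T = "poly (time e) n + (poly (time (Plus (Sum 2 (Var 0)) (Var 1))) n + poly (time f) n) + 2"
  have body: "\<exists>r'. runs ?body (r, m) ?T
      (r', m(1 := (m 1)(i := F i), 2 := (m 2)(i * n + j := G i j))) \<and> (\<forall>i. even i \<longrightarrow> r' i = r i)"
    if h: "r 0 = n" "r 2 = i" "r 4 = j" "i < n" "j < n" "m 0 = a" for r :: "nat \<Rightarrow> nat" and m i j
  proof -
    from compile_runs[of e 0 r m] obtain r1 where r1:
      "runs (compile e 0) (r, m) (poly (time e) n) (r1, m)"
      "r1 1 = eval n a e (\<lambda>x. r (2 * x + 2))" "\<forall>i. even i \<longrightarrow> r1 i = r i" using h by auto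
    have r11: "r1 1 = F i" using r1(2) F[of "\<lambda>x. r (2 * x + 2)"] h by (simp add: numeral_2_eq_2)
    let ?m1 = "m(1 := (m 1)(i := F i))"
    have st1: "runs (Store 1 2 1) (r1, m) 1 (r1, ?m1)"
      using runs_Store[of 1 2 1 r1 m] r11 r1(3) h by simp
    from compile_runs[of "Plus (Sum 2 (Var 0)) (Var 1)" 0 r1 ?m1] obtain r2 where r2:
      "runs (compile (Plus (Sum 2 (Var 0)) (Var 1)) 0) (r1, ?m1)
         (poly (time (Plus (Sum 2 (Var 0)) (Var 1))) (r1 0)) (r2, ?m1)"
      "r2 1 = eval (r1 0) (?m1 0) (Plus (Sum 2 (Var 0)) (Var 1)) (\<lambda>x. r1 (2 * x + 2))"
      "\<forall>i. even i \<longrightarrow> r2 i = r1 i" by auto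
    have r1n: "r1 0 = n" "r1 2 = i" "r1 4 = j" using r1(3) h by auto
    have r21: "r2 1 = i * n + j" using r2(2) r1n by (simp add: eval_nat_numeral mult.commute)
    from compile_runs[of f 1 r2 ?m1] obtain r3 where r3:
      "runs (compile f 1) (r2, ?m1) (poly (time f) (r2 0)) (r3, ?m1)"
      "r3 3 = eval (r2 0) (?m1 0) f (\<lambda>x. r2 (2 * x + 2))"
      "\<forall>i. even i \<or> i < 3 \<longrightarrow> r3 i = r2 i" by auto
    have r2n: "r2 0 = n" "r2 2 = i" "r2 4 = j" using r2(3) r1n by auto
    have r33: "r3 3 = G i j" using r3(2) r2n h G[of "\<lambda>x. r2 (2 * x + 2)"] by (simp add: eval_nat_numeral)
    have st2: "runs (Store 2 1 3) (r3, ?m1) 1 (r3, m(1 := (m 1)(i := F i), 2 := (m 2)(i * n + j := G i j)))"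
      using runs_Store[of 2 1 3 r3 ?m1] r33 r3(3) r21 by simp
    have "runs ?body (r, m) (poly (time e) n + (1 + (poly (time (Plus (Sum 2 (Var 0)) (Var 1))) n +
       (poly (time f) n + 1)))) (r3, m(1 := (m 1)(i := F i), 2 := (m 2)(i * n + j := G i j)))"
      using r2(1) r3(1) r1n(1) r2n(1)
      by (intro runs_Seq[OF r1(1)] runs_Seq[OF st1] runs_Seq[of _ _ _ "(r2, ?m1)"]
          runs_Seq[of _ _ _ "(r3, ?m1)"] st2) auto
    moreover have "\<forall>i. even i \<longrightarrow> r3 i = r i" using r1(3) r2(3) r3(3) by simp
    ultimately show ?thesis by (intro exI[of _ r3]) (auto simp: ac_simps)
  qed
  define J where "J = (\<lambda>k m. m 0 = a \<and> (\<forall>i<k. m 1 i = F i) \<and>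
     (\<forall>i<k. \<forall>j<n. m (2::nat) (i * n + j) = G i j))"
  have inner: "\<exists>r' m'. runs (for_loop 4 1 ?body) (r, m) (3 + n * (?T + 4)) (r', m') \<and> r' 0 = n \<and>
      (r' 2 = i \<and> J i m' \<and> (\<forall>j<n. m' 1 i = F i \<and> m' 2 (i * n + j) = G i j))"
    if h: "i < n" "J i m" "r 2 = i" "r 0 = n" for i m and r :: "nat \<Rightarrow> nat"
  proof -
    \<comment> \<open>The claim on array 1 sits under the bound on \<open>j\<close> because the
      first pass of the inner loop establishes it. As \<open>i < n\<close>, there is at least one
      pass.\<close>
    define I where "I = (\<lambda>k (r :: nat \<Rightarrow> nat) m. r 2 = i \<and> J i m \<and>
       (\<forall>j<k. m 1 i = F i \<and> m 2 (i * n + j) = G i j))"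
    have "\<exists>r' m'. runs (for_loop 4 1 ?body) (r, m) (3 + n * (?T + 4)) (r', m') \<and> r' 0 = n \<and> I n r' m'"
    proof (rule for_loop_runs)
      show "I 0 (r(4 := 0, 1 := n)) m" using h by (simp add: I_def)
    next
      fix k r m
      assume k: "k < n" "I k r m" "r 4 = k" "r 0 = n"
      then have "r 2 = i" "m 0 = a" by (auto simp: I_def J_def)
      from body[of r i k m, OF k(4) this(1) k(3) h(1) k(1) this(2)] obtain r' where
        r': "runs ?body (r, m) ?T (r', m(1 := (m 1)(i := F i), 2 := (m 2)(i * n + k := G i k)))"
        "\<forall>i. even i \<longrightarrow> r' i = r i" by blast
      moreover have "I (Suc k) (r'(4 := Suc k, 1 := n - Suc k))
          (m(1 := (m 1)(i := F i), 2 := (m 2)(i * n + k := G i k)))"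
        using k r'(2) h(1) by (auto simp: I_def J_def mult_add_eq_iff less_Suc_eq)
      ultimately show "\<exists>r' m'. runs ?body (r, m) ?T (r', m') \<and> r' 4 = k \<and> r' 0 = n \<and>
          I (Suc k) (r'(4 := Suc k, 1 := n - Suc k)) m'"
        using k r'(2) by (intro exI[of _ r'] exI conjI) auto
    qed (use h in auto)
    then show ?thesis by (simp add: I_def)
  qed
  have "\<exists>r' m'. runs (for_loop 2 1 (for_loop 4 1 ?body)) (r, m)
     (3 + n * ((3 + n * (?T + 4)) + 4)) (r', m') \<and> r' 0 = n \<and> J n m'"
  proof (rule for_loop_runs)
    fix k m and r :: "nat \<Rightarrow> nat"
    assume k: "k < n" "J k m" "r 2 = k" "r 0 = n"
    from inner[OF this] obtain r' m' where
      "runs (for_loop 4 1 ?body) (r, m) (3 + n * (?T + 4)) (r', m')" "r' 0 = n" "r' 2 = k" "J k m'"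
      "\<forall>j<n. m' 1 k = F k \<and> m' 2 (k * n + j) = G k j" by blast
    moreover from this have "J (Suc k) m'" using k by (auto simp: J_def less_Suc_eq)
    ultimately show "\<exists>r' m'. runs (for_loop 4 1 ?body) (r, m) (3 + n * (?T + 4)) (r', m') \<and>
       r' 2 = k \<and> r' 0 = n \<and> J (Suc k) m'" by blast
  qed (use r m in \<open>auto simp: J_def\<close>)
  then obtain r' m' t where "exec (fill_tables e f) (r, m) t (r', m')" "J n m'"
    "t \<le> 3 + n * ((3 + n * (?T + 4)) + 4)"
    unfolding runs_def fill_tables_def by blast
  moreover have "3 + n * ((3 + n * (?T + 4)) + 4) = poly p n"
    unfolding p_def by (simp add: algebra_simps)
  ultimately show ?thesis by (intro exI[of _ t] exI[of _ "(r', m')"]) (auto simp: J_def)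
qed

section \<open>Optimal clusterings and atoms\<close>

lemma card_sym_diff_commute: "card (sym_diff A B) = card (sym_diff B A)"
  by (simp add: Un_commute)

lemma card_sym_diff_triangle:
  assumes "finite A" "finite B" "finite C"
  shows "card (sym_diff A C) \<le> card (sym_diff A B) + card (sym_diff B C)"
proof -
  have "card (sym_diff A C) \<le> card (sym_diff A B \<union> sym_diff B C)"
    using assms by (intro card_mono) auto
  then show ?thesis using card_Un_le le_trans by blast
qed

lemma card_le_card_sym_diff:
  assumes "finite A" "finite B"
  shows "card A \<le> card B + card (sym_diff A B)"
proof -
  have "card A \<le> card (B \<union> sym_diff A B)" using assms by (intro card_mono) auto
  then show ?thesis using card_Un_le le_trans by blast
qed

lemma sum_card_Collect_swap:
  assumes "finite A" "finite B"
  shows "(\<Sum>a\<in>A. card {b \<in> B. P a b}) = (\<Sum>b\<in>B. card {a \<in> A. P a b})"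
proof -
  have "(\<Sum>a\<in>A. card {b \<in> B. P a b}) = (\<Sum>a\<in>A. \<Sum>b\<in>B. of_bool (P a b))"
    using assms by (simp add: of_bool_def sum.If_cases Int_def)
  also have "\<dots> = (\<Sum>b\<in>B. \<Sum>a\<in>A. of_bool (P a b))" by (rule sum.swap)
  also have "\<dots> = (\<Sum>b\<in>B. card {a \<in> A. P a b})"
    using assms by (simp add: of_bool_def sum.If_cases Int_def)
  finally show ?thesis .
qed

text \<open>Reflexivity makes neighbourhoods closed: an isolated positive clique is the
  neighbourhood of each of its members, and no vertex disagrees with itself.\<close>

locale refl_graph =
  fixes V :: "'a set" and adj :: "'a \<Rightarrow> 'a \<Rightarrow> bool"
  assumes finite_V: "finite V" and adj_refl: "adj u u" and adj_sym: "adj u v \<Longrightarrow> adj v u"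
begin

definition nb :: "'a \<Rightarrow> 'a set" where "nb u = {v \<in> V. adj u v}"

definition cls :: "('a \<Rightarrow> nat) \<Rightarrow> 'a \<Rightarrow> 'a set" where "cls f u = {v \<in> V. f v = f u}"

definition mis :: "('a \<Rightarrow> nat) \<Rightarrow> 'a \<Rightarrow> 'a \<Rightarrow> nat" where "mis f u v = of_bool (adj u v \<noteq> (f u = f v))"

abbreviation dis :: "('a \<Rightarrow> nat) \<Rightarrow> 'a \<Rightarrow> nat" where "dis f u \<equiv> card (sym_diff (nb u) (cls f u))"

definition cost2 :: "('a \<Rightarrow> nat) \<Rightarrow> nat" where "cost2 f = (\<Sum>u\<in>V. \<Sum>v\<in>V. mis f u v)"

definition optimal :: "('a \<Rightarrow> nat) \<Rightarrow> bool" where "optimal f \<longleftrightarrow> (\<forall>g. cost2 f \<le> cost2 g)"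

lemma adj_commute: "adj u v \<longleftrightarrow> adj v u"
  using adj_sym by blast

lemma mis_commute: "mis f u v = mis f v u"
  unfolding mis_def by (simp only: adj_commute[of u v] eq_commute[of "f u"])

lemma mis_self [simp]: "mis f u u = 0"
  by (simp add: mis_def adj_refl)

lemma finite_nb [simp]: "finite (nb u)" and finite_cls [simp]: "finite (cls f u)"
  using finite_V by (auto simp: nb_def cls_def)

lemma cls_subset: "cls f u \<subseteq> V"
  by (auto simp: cls_def)

lemma self_nb: "u \<in> V \<Longrightarrow> u \<in> nb u" and self_cls: "u \<in> V \<Longrightarrow> u \<in> cls f u"
  by (auto simp: nb_def cls_def adj_refl)

lemma finite_subset_V: "S \<subseteq> V \<Longrightarrow> finite S"
  using finite_V finite_subset by blast

lemma card_cls_pos: "u \<in> V \<Longrightarrow> 0 < card (cls f u)" and card_nb_pos: "u \<in> V \<Longrightarrow> 0 < card (nb u)"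
  using self_cls self_nb by (auto simp: card_gt_0_iff)

lemma cls_eq: "f u = f v \<Longrightarrow> cls f u = cls f v"
  by (simp add: cls_def)

lemma sum_of_bool_card: "finite A \<Longrightarrow> (\<Sum>v\<in>A. of_bool (P v)) = card {v \<in> A. P v}"
  by (simp add: of_bool_def sum.If_cases Int_def)

lemma dis_eq_sum_mis: "dis f u = (\<Sum>v\<in>V. mis f u v)"
proof -
  have "sym_diff (nb u) (cls f u) = {v \<in> V. adj u v \<noteq> (f u = f v)}"
    by (auto simp: nb_def cls_def)
  then show ?thesis unfolding mis_def by (simp only: sum_of_bool_card[OF finite_V])
qed

lemma cost2_eq_sum_dis: "cost2 f = (\<Sum>u\<in>V. dis f u)"
  unfolding cost2_def dis_eq_sum_mis ..

lemma card_nb_le: "card (nb u) \<le> card (cls f u) + dis f u"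
  by (rule card_le_card_sym_diff) auto

text \<open>By symmetry, the pairs with exactly one end in \<open>S\<close> can all be read from
  inside \<open>S\<close>, whence the factor 2. A relabelling of \<open>S\<close> leaves the last
  sum unchanged.\<close>

lemma cost2_split:
  assumes "S \<subseteq> V"
  shows "cost2 f = (\<Sum>u\<in>S. (\<Sum>v\<in>S. mis f u v) + 2 * (\<Sum>v\<in>V-S. mis f u v))
    + (\<Sum>u\<in>V-S. \<Sum>v\<in>V-S. mis f u v)"
proof -
  note fin = finite_V finite_subset_V[OF assms]
  have V: "(\<Sum>v\<in>V. h v) = (\<Sum>v\<in>S. h v) + (\<Sum>v\<in>V-S. h v)" for h :: "'a \<Rightarrow> nat"
    using sum.subset_diff[OF assms finite_V, of h] by simp
  have "(\<Sum>u\<in>V-S. \<Sum>v\<in>S. mis f u v) = (\<Sum>u\<in>S. \<Sum>v\<in>V-S. mis f u v)"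
    by (subst sum.swap) (intro sum.cong refl mis_commute)
  then show ?thesis unfolding cost2_def V by (simp add: sum.distrib algebra_simps mult_2)
qed

section \<open>Consequences of local optimality\<close>

lemma optimal_relabel:
  assumes "optimal f" "S \<subseteq> V" and g: "\<And>u. u \<in> V - S \<Longrightarrow> g u = f u"
  shows "(\<Sum>u\<in>S. (\<Sum>v\<in>S. mis f u v) + 2 * (\<Sum>v\<in>V-S. mis f u v))
    \<le> (\<Sum>u\<in>S. (\<Sum>v\<in>S. mis g u v) + 2 * (\<Sum>v\<in>V-S. mis g u v))"
proof -
  have "(\<Sum>u\<in>V-S. \<Sum>v\<in>V-S. mis g u v) = (\<Sum>u\<in>V-S. \<Sum>v\<in>V-S. mis f u v)"
    by (intro sum.cong refl) (auto simp: mis_def g)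
  moreover have "cost2 f \<le> cost2 g" using assms(1) by (simp add: optimal_def)
  ultimately show ?thesis unfolding cost2_split[OF assms(2)] by linarith
qed

lemma fresh_label: obtains l where "\<And>u. u \<in> V \<Longrightarrow> f u \<noteq> (l :: nat)"
proof -
  obtain l where "l \<notin> f ` V" using ex_new_if_finite[OF infinite_UNIV_nat] finite_V by blast
  then show ?thesis using that by (metis imageI)
qed

text \<open>Splitting \<open>S\<close> off as a new cluster affects only the pairs between
  \<open>S\<close> and the rest of its cluster: edges become errors and non-edges cease to be
  errors. Optimality thus forces at least half of these pairs to be edges.\<close>

lemma optimal_cut:
  assumes "optimal f" "S \<subseteq> cls f c"
  shows "card S * card (cls f c - S) \<le> 2 * (\<Sum>u\<in>S. card (nb u \<inter> (cls f c - S)))"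
proof -
  let ?T = "cls f c - S"
  have SV: "S \<subseteq> V" using assms(2) cls_subset by blast
  obtain l where l: "\<And>u. u \<in> V \<Longrightarrow> f u \<noteq> l" by (rule fresh_label[of f]) blast
  define g where "g u = (if u \<in> S then l else f u)" for u
  have fin: "finite S" "finite ?T" using SV finite_subset_V by auto
  have VS: "V - S = ?T \<union> (V - cls f c)" using assms(2) cls_subset by auto
  have fS: "f u = f c" if "u \<in> S" for u using that assms(2) by (auto simp: cls_def)
  have split: "(\<Sum>v\<in>V-S. h v) = (\<Sum>v\<in>?T. h v) + (\<Sum>v\<in>V-cls f c. h v)" for h :: "'a \<Rightarrow> nat"
    unfolding VS using finite_V by (subst sum.union_disjoint) auto
  have in_eq: "mis g u v = mis f u v" if "u \<in> S" "v \<in> S" for u v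
    using that fS by (simp add: mis_def g_def)
  have out_eq: "(\<Sum>v\<in>V-cls f c. mis g u v) = (\<Sum>v\<in>V-cls f c. mis f u v)" if "u \<in> S" for u
  proof (rule sum.cong)
    fix v assume "v \<in> V - cls f c"
    then show "mis g u v = mis f u v"
      using that fS assms(2) l[of v] by (auto simp: mis_def g_def cls_def)
  qed simp
  have f_T: "(\<Sum>v\<in>?T. mis f u v) + card (nb u \<inter> ?T) = card ?T" if "u \<in> S" for u
  proof -
    have "(\<Sum>v\<in>?T. mis f u v) = (\<Sum>v\<in>?T. of_bool (\<not> adj u v))"
      using that fS by (intro sum.cong) (auto simp: mis_def cls_def)
    also have "\<dots> = card {v \<in> ?T. \<not> adj u v}" by (rule sum_of_bool_card[OF fin(2)])
    finally have "(\<Sum>v\<in>?T. mis f u v) + card (nb u \<inter> ?T) = card ({v \<in> ?T. \<not> adj u v} \<union> (nb u \<inter> ?T))"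
      using fin by (subst card_Un_disjoint) (auto simp: nb_def)
    also have "{v \<in> ?T. \<not> adj u v} \<union> (nb u \<inter> ?T) = ?T" using cls_subset[of f c] by (auto simp: nb_def)
    finally show ?thesis .
  qed
  have g_T: "(\<Sum>v\<in>?T. mis g u v) = card (nb u \<inter> ?T)" if "u \<in> S" for u
  proof -
    have "(\<Sum>v\<in>?T. mis g u v) = (\<Sum>v\<in>?T. of_bool (adj u v))"
      using that l cls_subset[of f c] by (intro sum.cong) (auto simp: mis_def g_def)
    also have "\<dots> = card {v \<in> ?T. adj u v}" by (rule sum_of_bool_card[OF fin(2)])
    also have "{v \<in> ?T. adj u v} = nb u \<inter> ?T" using cls_subset[of f c] by (auto simp: nb_def)
    finally show ?thesis .
  qed
  have "(\<Sum>u\<in>S. (\<Sum>v\<in>S. mis f u v) + 2 * (\<Sum>v\<in>V-S. mis f u v))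
    \<le> (\<Sum>u\<in>S. (\<Sum>v\<in>S. mis g u v) + 2 * (\<Sum>v\<in>V-S. mis g u v))"
    by (rule optimal_relabel[OF assms(1) SV]) (simp add: g_def)
  moreover have "(\<Sum>u\<in>S. \<Sum>v\<in>S. mis g u v) = (\<Sum>u\<in>S. \<Sum>v\<in>S. mis f u v)"
    using in_eq by (intro sum.cong) auto
  moreover have "(\<Sum>u\<in>S. \<Sum>v\<in>V-cls f c. mis g u v) = (\<Sum>u\<in>S. \<Sum>v\<in>V-cls f c. mis f u v)"
    by (rule sum.cong[OF refl out_eq])
  ultimately have "(\<Sum>u\<in>S. \<Sum>v\<in>?T. mis f u v) \<le> (\<Sum>u\<in>S. \<Sum>v\<in>?T. mis g u v)"
    by (simp add: sum.distrib split sum_distrib_left[symmetric])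
  then have "(\<Sum>u\<in>S. (\<Sum>v\<in>?T. mis f u v) + card (nb u \<inter> ?T)) \<le> (\<Sum>u\<in>S. 2 * card (nb u \<inter> ?T))"
    using g_T by (simp add: sum.distrib mult_2)
  also have "(\<Sum>u\<in>S. (\<Sum>v\<in>?T. mis f u v) + card (nb u \<inter> ?T)) = card S * card ?T"
    using f_T by simp
  finally show ?thesis by (simp add: sum_distrib_left)
qed

lemma optimal_move:
  assumes "optimal f" "v \<in> V" "w \<in> V"
  shows "dis f v \<le> card (sym_diff (nb v) (insert v (cls f w)))"
proof -
  let ?g = "f(v := f w)"
  have *: "dis h v = (\<Sum>x\<in>V-{v}. mis h v x)" for h
    unfolding dis_eq_sum_mis using assms(2) finite_V by (subst sum.remove[of _ v]) auto
  have "dis f v \<le> dis ?g v"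
    using optimal_relabel[OF assms(1), of "{v}" ?g] assms(2) unfolding * by simp
  also have "cls ?g v = insert v (cls f w)" using assms by (auto simp: cls_def)
  finally show ?thesis .
qed

text \<open>This is the cut of the single vertex \<open>u\<close>. Leaving out \<open>u\<close>
  itself costs 1 on the left and 2 on the right, so the bound survives its return to both
  sides.\<close>

lemma optimal_degree:
  assumes "optimal f" "u \<in> V"
  shows "card (cls f u) \<le> 2 * card (nb u \<inter> cls f u)"
proof -
  have "card {u} * card (cls f u - {u}) \<le> 2 * (\<Sum>x\<in>{u}. card (nb x \<inter> (cls f u - {u})))"
    by (rule optimal_cut[OF assms(1)]) (simp add: self_cls assms)
  moreover have "nb u \<inter> (cls f u - {u}) = (nb u \<inter> cls f u) - {u}" by auto
  moreover have "u \<in> nb u \<inter> cls f u" using self_nb self_cls assms by auto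
  ultimately show ?thesis using card_Suc_Diff1[of "nb u \<inter> cls f u" u] card_Suc_Diff1[of "cls f u" u] by auto
qed

section \<open>Atoms inside optimal clusters\<close>

definition atom :: "'a set \<Rightarrow> bool" where
  "atom K \<longleftrightarrow> K \<subseteq> V \<and> K \<noteq> {} \<and> (\<forall>v\<in>K. 16 * card (sym_diff (nb v) K) \<le> card K)"

lemma atom_subset: "atom K \<Longrightarrow> K \<subseteq> V"
  by (simp add: atom_def)

lemma atom_dis: "atom K \<Longrightarrow> v \<in> K \<Longrightarrow> 16 * card (sym_diff (nb v) K) \<le> card K"
  by (simp add: atom_def)

lemma atom_finite: "atom K \<Longrightarrow> finite K" and atom_card_pos: "atom K \<Longrightarrow> 0 < card K"
  using finite_subset_V by (auto simp: atom_def card_gt_0_iff)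

text \<open>Cut the cluster along \<open>K\<close>: every vertex of \<open>K\<close> has at most
  |K|/16 neighbours outside \<open>K\<close>, while edges make up at least half of the pairs across
  the cut.\<close>

lemma atom_surroundings:
  assumes "optimal f" "atom K" "u \<in> K"
  shows "8 * card (cls f u - K) \<le> card K"
proof -
  let ?S = "K \<inter> cls f u" and ?T = "cls f u - K"
  have T: "cls f u - ?S = ?T" by auto
  have u: "u \<in> ?S" using assms self_cls atom_subset by blast
  have "card ?S * card ?T \<le> 2 * (\<Sum>v\<in>?S. card (nb v \<inter> ?T))"
    using optimal_cut[OF assms(1), of ?S u] unfolding T by blast
  then have "8 * (card ?S * card ?T) \<le> (\<Sum>v\<in>?S. 16 * card (nb v \<inter> ?T))"
    unfolding sum_distrib_left[symmetric] by linarith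
  also have "\<dots> \<le> (\<Sum>v\<in>?S. card K)"
  proof (rule sum_mono)
    fix v assume v: "v \<in> ?S"
    have "card (nb v \<inter> ?T) \<le> card (sym_diff (nb v) K)"
      using atom_finite[OF assms(2)] by (intro card_mono) auto
    with v atom_dis[OF assms(2), of v] show "16 * card (nb v \<inter> ?T) \<le> card K" by simp
  qed
  finally have "card ?S * (8 * card ?T) \<le> card ?S * card K" by simp
  moreover have "0 < card ?S" using u atom_finite[OF assms(2)] by (auto simp: card_gt_0_iff)
  ultimately show ?thesis by simp
qed

text \<open>Turning the atom into a cluster of its own shows that one cluster contains most of it.\<close>

lemma atom_majority:
  assumes "optimal f" "atom K"
  shows "\<exists>u\<in>K. 16 * card (K - cls f u) \<le> 3 * card K"
proof -
  let ?k = "card K"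
  have KV: "K \<subseteq> V" and fin: "finite K" using assms atom_finite atom_subset by blast+
  obtain l where l: "\<And>u. u \<in> V \<Longrightarrow> f u \<noteq> l" by (rule fresh_label[of f]) blast
  define g where "g u = (if u \<in> K then l else f u)" for u
  define d where "d u = card (sym_diff (nb u) K)" for u
  have g: "(\<Sum>v\<in>K. mis g u v) + 2 * (\<Sum>v\<in>V-K. mis g u v) \<le> 2 * d u" if "u \<in> K" for u
  proof -
    have "cls g u = K" using that l KV by (auto simp: cls_def g_def split: if_splits)
    then have "d u = (\<Sum>v\<in>V. mis g u v)" using dis_eq_sum_mis[of u g] by (simp add: d_def)
    also have "\<dots> = (\<Sum>v\<in>K. mis g u v) + (\<Sum>v\<in>V-K. mis g u v)"
      using sum.subset_diff[OF KV finite_V, of "mis g u"] by simp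
    finally show ?thesis by simp
  qed
  \<comment> \<open>A vertex of \<open>K\<close> in another cluster is an error if adjacent to
    \<open>u\<close>; otherwise it belongs to the symmetric difference counted by
    \<open>d u\<close>.\<close>
  have f: "card (K - cls f u) \<le> (\<Sum>v\<in>K. mis f u v) + d u" if "u \<in> K" for u
  proof -
    have "(\<Sum>v\<in>K. mis f u v) = card {v \<in> K. adj u v \<noteq> (f u = f v)}"
      unfolding mis_def using fin by (rule sum_of_bool_card)
    moreover have "card (K - cls f u) \<le> card ({v \<in> K. adj u v \<noteq> (f u = f v)} \<union> sym_diff (nb u) K)"
      using fin KV finite_V by (intro card_mono) (auto simp: cls_def nb_def)
    moreover note card_Un_le[of "{v \<in> K. adj u v \<noteq> (f u = f v)}" "sym_diff (nb u) K"]
    ultimately show ?thesis unfolding d_def by linarith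
  qed
  \<comment> \<open>One \<open>d u\<close> comes from the missing edges and two from the comparison
    with \<open>g\<close>. As \<open>d u\<close> is at most |K|/16, averaging over \<open>K\<close>
    gives the fraction 3/16.\<close>
  have "(\<Sum>u\<in>K. card (K - cls f u)) \<le> (\<Sum>u\<in>K. (\<Sum>v\<in>K. mis f u v) + d u)"
    using f by (rule sum_mono)
  also have "\<dots> \<le> (\<Sum>u\<in>K. (\<Sum>v\<in>K. mis f u v) + 2 * (\<Sum>v\<in>V-K. mis f u v)) + (\<Sum>u\<in>K. d u)"
    by (simp add: sum.distrib)
  also have "(\<Sum>u\<in>K. (\<Sum>v\<in>K. mis f u v) + 2 * (\<Sum>v\<in>V-K. mis f u v))
      \<le> (\<Sum>u\<in>K. (\<Sum>v\<in>K. mis g u v) + 2 * (\<Sum>v\<in>V-K. mis g u v))"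
    by (rule optimal_relabel[OF assms(1) KV]) (simp add: g_def)
  also have "\<dots> \<le> (\<Sum>u\<in>K. 2 * d u)" using g by (rule sum_mono)
  finally have "(\<Sum>u\<in>K. 16 * card (K - cls f u)) \<le> (\<Sum>u\<in>K. 3 * (16 * d u))"
    by (simp add: sum_distrib_left[symmetric])
  also have "\<dots> \<le> (\<Sum>u\<in>K. 3 * ?k)"
    unfolding d_def by (intro sum_mono mult_le_mono2 atom_dis[OF assms(2)])
  finally have *: "(\<Sum>u\<in>K. 16 * card (K - cls f u)) \<le> (\<Sum>u\<in>K. 3 * ?k)" .
  show ?thesis
  proof (rule ccontr)
    assume "\<not> ?thesis"
    then have "(\<Sum>u\<in>K. 3 * ?k) < (\<Sum>u\<in>K. 16 * card (K - cls f u))"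
      using fin atom_card_pos[OF assms(2)] by (intro sum_strict_mono) (auto simp: not_le)
    with * show False by simp
  qed
qed

text \<open>A vertex of \<open>K\<close> outside the majority cluster disagrees with at least 1 -
  3/16 - 1/16 = 12/16 of |K| vertices, since it is adjacent to most of \<open>K\<close>. Moved to
  the majority cluster it would disagree with at most 1/16 + 3/16 + 2/16 = 6/16 of |K|.\<close>

lemma atom_unsplit:
  assumes "optimal f" "atom K" "u \<in> K" "v \<in> K"
  shows "f u = f v"
proof -
  have KV: "K \<subseteq> V" and fin: "finite K" using assms atom_finite atom_subset by blast+
  obtain w where w: "w \<in> K" "16 * card (K - cls f w) \<le> 3 * card K"
    using atom_majority[OF assms(1,2)] by blast
  have surr: "8 * card (cls f w - K) \<le> card K" by (rule atom_surroundings[OF assms(1,2) w(1)])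
  have "f x = f w" if x: "x \<in> K" for x
  proof (rule ccontr)
    assume ne: "f x \<noteq> f w"
    let ?C = "cls f w"
    have xV: "x \<in> V" "w \<in> V" using x w KV by auto
    have d: "16 * card (sym_diff (nb x) K) \<le> card K" by (rule atom_dis[OF assms(2) x])
    have "card (sym_diff (nb x) (insert x ?C))
        \<le> card (sym_diff (nb x) K) + card (sym_diff K (insert x ?C))"
      using fin by (intro card_sym_diff_triangle) auto
    also have "card (sym_diff K (insert x ?C)) \<le> card ((K - ?C) \<union> (?C - K))"
      using fin x by (intro card_mono) auto
    also have "\<dots> \<le> card (K - ?C) + card (?C - K)" by (rule card_Un_le)
    finally have up: "dis f x \<le> card (sym_diff (nb x) K) + (card (K - ?C) + card (?C - K))"
      using optimal_move[OF assms(1) xV] by linarith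
    have "card K \<le> card (K - ?C) + card (K \<inter> ?C)"
      using card_Un_le[of "K - ?C" "K \<inter> ?C"] by (simp only: Un_Diff_Int)
    also have "card (K \<inter> ?C) \<le> card (sym_diff (nb x) K \<union> sym_diff (nb x) (cls f x))"
      using fin ne finite_V by (intro card_mono) (auto simp: cls_def)
    also have "\<dots> \<le> card (sym_diff (nb x) K) + dis f x" by (rule card_Un_le)
    finally have "card K \<le> card (K - ?C) + (card (sym_diff (nb x) K) + dis f x)" by simp
    with up d w(2) surr atom_card_pos[OF assms(2)] show False by linarith
  qed
  then show ?thesis using assms by metis
qed

lemma atom_subset_cls: "optimal f \<Longrightarrow> atom K \<Longrightarrow> u \<in> K \<Longrightarrow> K \<subseteq> cls f u"
  using atom_unsplit[of f K] atom_subset[of K] unfolding cls_def by blast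

text \<open>Two disjoint atoms in one cluster would each lie in the surroundings of the other and so
  have at most an eighth of its size. Sharing a cluster thereby becomes readable from the
  graph.\<close>

lemma atoms_same_cluster_iff:
  assumes "optimal f" "atom K" "atom L" "u \<in> K" "v \<in> L"
  shows "f u = f v \<longleftrightarrow> K \<inter> L \<noteq> {}"
proof
  assume "K \<inter> L \<noteq> {}"
  then obtain w where "w \<in> K" "w \<in> L" by auto
  then show "f u = f v" using atom_unsplit[OF assms(1,2)] atom_unsplit[OF assms(1,3)] assms(4,5) by metis
next
  assume eq: "f u = f v"
  show "K \<inter> L \<noteq> {}"
  proof
    assume disj: "K \<inter> L = {}"
    have fin: "finite K" "finite L" using assms atom_finite by auto
    have "L \<subseteq> cls f u - K" "K \<subseteq> cls f v - L"
      using atom_subset_cls[OF assms(1,3,5)] atom_subset_cls[OF assms(1,2,4)] cls_eq[of f u v] eq disj by auto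
    then have "card L \<le> card (cls f u - K)" "card K \<le> card (cls f v - L)"
      by (auto intro!: card_mono)
    moreover have "8 * card (cls f u - K) \<le> card K" "8 * card (cls f v - L) \<le> card L"
      using atom_surroundings assms by blast+
    ultimately show False using atom_card_pos assms(2) by fastforce
  qed
qed

section \<open>Uncovered vertices and admissible pairs\<close>

lemma sum_by_cluster:
  fixes h h' :: "'a \<Rightarrow> nat"
  assumes "\<And>c. c \<in> V \<Longrightarrow> (\<Sum>u\<in>cls f c. h u) \<le> (\<Sum>u\<in>cls f c. h' u)"
  shows "(\<Sum>u\<in>V. h u) \<le> (\<Sum>u\<in>V. h' u)"
proof -
  have eq: "(\<Sum>u\<in>V. k u) = (\<Sum>y\<in>f ` V. \<Sum>u\<in>{u \<in> V. f u = y}. k u)" for k :: "'a \<Rightarrow> nat"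
    by (rule sum.image_gen[OF finite_V])
  have "(\<Sum>u\<in>{u \<in> V. f u = y}. h u) \<le> (\<Sum>u\<in>{u \<in> V. f u = y}. h' u)" if "y \<in> f ` V" for y
    using that assms by (auto simp: cls_def)
  then show ?thesis unfolding eq by (rule sum_mono)
qed

section \<open>Candidate atoms and covered vertices\<close>

definition core :: "'a \<Rightarrow> 'a set" where
  "core u = {v \<in> V. 64 * card (sym_diff (nb u) (nb v)) \<le> card (nb u)}"

definition valid :: "'a \<Rightarrow> bool" where
  "valid u \<longleftrightarrow> u \<in> V \<and> (\<forall>v\<in>core u. 16 * card (sym_diff (nb v) (core u)) \<le> card (core u))"

definition covered :: "'a \<Rightarrow> bool" where
  "covered v \<longleftrightarrow> (\<exists>u. valid u \<and> v \<in> core u)"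

text \<open>No clustering is mentioned, so the relation is computable from the input; for covered
  vertices it nevertheless means sharing a cluster in every optimal clustering, see
  \<open>linked_iff\<close>.\<close>

definition linked :: "'a \<Rightarrow> 'a \<Rightarrow> bool" where
  "linked y v \<longleftrightarrow> (\<exists>u w. valid u \<and> y \<in> core u \<and> valid w \<and> v \<in> core w \<and> core u \<inter> core w \<noteq> {})"

lemma self_core: "u \<in> V \<Longrightarrow> u \<in> core u" and core_subset: "core u \<subseteq> V"
  by (auto simp: core_def)

lemma finite_core [simp]: "finite (core u)"
  using core_subset finite_subset_V by blast

lemma valid_atom: "valid u \<Longrightarrow> atom (core u)"
  using self_core core_subset unfolding valid_def atom_def by blast

lemma covered_in_V: "covered v \<Longrightarrow> v \<in> V"
  using core_subset unfolding covered_def by blast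

lemma linked_iff:
  assumes "optimal f"
  shows "linked y v \<longleftrightarrow> covered y \<and> covered v \<and> f y = f v"
  using atoms_same_cluster_iff[OF assms] valid_atom unfolding linked_def covered_def by metis

text \<open>Neighbourhoods of good vertices are within k/192 of the cluster, where k is its size,
  hence close to each other, so the core contains all good vertices. Few others can join it, so the
  core, the cluster and the neighbourhoods of the core vertices nearly agree.\<close>

lemma valid_of_dense_cluster:
  defines "G f c \<equiv> {v \<in> cls f c. 192 * dis f v \<le> card (cls f c)}"
  assumes c: "192 * card (cls f c - G f c) \<le> card (cls f c)" and u: "u \<in> G f c"
  shows "valid u"
proof -
  let ?C = "cls f c" and ?G = "G f c" and ?S = "core u"
  let ?k = "card ?C" and ?W = "?S - ?C"
  have GC: "?G \<subseteq> ?C" by (auto simp: G_def)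
  have finG: "finite ?G" using GC finite_subset finite_cls by blast
  have dG: "192 * card (sym_diff (nb v) ?C) \<le> ?k" if "v \<in> ?G" for v
  proof -
    have "cls f v = ?C" using that by (intro cls_eq) (auto simp: G_def cls_def)
    then show ?thesis using that by (simp add: G_def)
  qed
  have uV: "u \<in> V" using u GC cls_subset by blast
  have k_u: "?k \<le> card (nb u) + card (sym_diff (nb u) ?C)"
    using card_le_card_sym_diff[of ?C "nb u"] by (simp add: card_sym_diff_commute)
  have u_k: "card (nb u) \<le> ?k + card (sym_diff (nb u) ?C)"
    by (rule card_le_card_sym_diff) auto
  have GS: "?G \<subseteq> ?S"
  proof
    fix v assume v: "v \<in> ?G"
    have "card (sym_diff (nb u) (nb v)) \<le> card (sym_diff (nb u) ?C) + card (sym_diff ?C (nb v))"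
      by (rule card_sym_diff_triangle) auto
    also have "card (sym_diff ?C (nb v)) = card (sym_diff (nb v) ?C)" by (rule card_sym_diff_commute)
    finally have "64 * card (sym_diff (nb u) (nb v)) \<le> card (nb u)"
      using dG[OF u] dG[OF v] k_u by linarith
    then show "v \<in> ?S" using v GC cls_subset by (auto simp: core_def)
  qed
  have dS: "192 * card (sym_diff (nb v) ?C) \<le> 5 * ?k" if "v \<in> ?S" for v
  proof -
    have "card (sym_diff (nb v) ?C) \<le> card (sym_diff (nb v) (nb u)) + card (sym_diff (nb u) ?C)"
      by (rule card_sym_diff_triangle) auto
    also have "card (sym_diff (nb v) (nb u)) = card (sym_diff (nb u) (nb v))" by (rule card_sym_diff_commute)
    finally have "64 * card (sym_diff (nb v) ?C) \<le> card (nb u) + 64 * card (sym_diff (nb u) ?C)"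
      using that unfolding core_def by auto
    then show ?thesis using u_k dG[OF u] by linarith
  qed
  have Gk: "?k = card ?G + card (?C - ?G)"
    using card_Diff_subset[OF finG GC] card_mono[OF _ GC] by simp
  have k_pos: "0 < ?k" using u GC by (auto simp: card_gt_0_iff)
  \<comment> \<open>At least 191/192 k vertices are good, and at most 5/192 k of them are
    non-neighbours of \<open>w\<close>.\<close>
  have W_nb: "186 * ?k \<le> 192 * card {x \<in> ?G. adj w x}" if w: "w \<in> ?W" for w
  proof -
    have "card ?G \<le> card ({x \<in> ?G. adj w x} \<union> sym_diff (nb w) ?C)"
      using finG GC cls_subset[of f c] finite_V by (intro card_mono) (auto simp: nb_def)
    also have "\<dots> \<le> card {x \<in> ?G. adj w x} + card (sym_diff (nb w) ?C)" by (rule card_Un_le)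
    finally show ?thesis using dS[of w] w c Gk by auto
  qed
  \<comment> \<open>Edges between the outsiders \<open>?W\<close> and the good vertices are counted
    from both sides: a good vertex has at most k/192 neighbours outside the cluster.\<close>
  have "(\<Sum>w\<in>?W. 186 * ?k) \<le> (\<Sum>w\<in>?W. 192 * card {x \<in> ?G. adj w x})"
    using W_nb by (rule sum_mono)
  also have "\<dots> = 192 * (\<Sum>w\<in>?W. card {x \<in> ?G. adj w x})" by (simp add: sum_distrib_left)
  also have "(\<Sum>w\<in>?W. card {x \<in> ?G. adj w x}) = (\<Sum>x\<in>?G. card {w \<in> ?W. adj w x})"
    using finG by (intro sum_card_Collect_swap) auto
  also have "192 * \<dots> = (\<Sum>x\<in>?G. 192 * card {w \<in> ?W. adj w x})" by (simp add: sum_distrib_left)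
  also have "\<dots> \<le> (\<Sum>x\<in>?G. ?k)"
  proof (rule sum_mono)
    fix x assume x: "x \<in> ?G"
    have "card {w \<in> ?W. adj w x} \<le> card (sym_diff (nb x) ?C)"
      using core_subset adj_sym by (intro card_mono) (auto simp: nb_def[of x] finite_V)
    then show "192 * card {w \<in> ?W. adj w x} \<le> ?k" using dG[OF x] by linarith
  qed
  also have "\<dots> \<le> ?k * ?k" using card_mono[OF _ GC] by simp
  finally have W: "186 * card ?W \<le> ?k" using k_pos by simp
  have "card (sym_diff ?C ?S) \<le> card (?C - ?G \<union> ?W)"
    using GS by (intro card_mono) auto
  also have "\<dots> \<le> card (?C - ?G) + card ?W" by (rule card_Un_le)
  finally have CS: "card (sym_diff ?C ?S) \<le> card (?C - ?G) + card ?W" .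
  have "16 * card (sym_diff (nb v) ?S) \<le> card ?S" if v: "v \<in> ?S" for v
  proof -
    have "card (sym_diff (nb v) ?S) \<le> card (sym_diff (nb v) ?C) + card (sym_diff ?C ?S)"
      by (rule card_sym_diff_triangle) auto
    moreover have "card ?G \<le> card ?S" using GS by (intro card_mono) auto
    ultimately show ?thesis using dS[OF v] CS W c Gk by linarith
  qed
  then show ?thesis using uV by (simp add: valid_def)
qed

text \<open>In a cluster of size k with few bad vertices, the uncovered ones are bad, so k < 192
  \<open>dis f u\<close> and each pays for its own degree. Otherwise more than k/192 bad vertices
  have over k/192 disagreements each, which pays for k^2. This gives 36865 = 192^2 + 1.\<close>

lemma sum_uncovered_degree:
  "(\<Sum>u\<in>V. if covered u then 0 else card (nb u)) \<le> 36865 * cost2 f"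
proof -
  have "(\<Sum>u\<in>V. if covered u then 0 else card (nb u)) \<le> (\<Sum>u\<in>V. 36865 * dis f u)"
  proof (rule sum_by_cluster)
    fix c assume "c \<in> V"
    let ?C = "cls f c" and ?G = "{v \<in> cls f c. 192 * dis f v \<le> card (cls f c)}"
    let ?k = "card ?C" and ?B = "?C - ?G"
    have deg: "card (nb u) \<le> ?k + dis f u" if "u \<in> ?C" for u
      using card_nb_le[of u f] that cls_eq[of f u c] by (simp add: cls_def)
    show "(\<Sum>u\<in>?C. if covered u then 0 else card (nb u)) \<le> (\<Sum>u\<in>?C. 36865 * dis f u)"
    proof (cases "192 * card ?B \<le> ?k")
      case True
      show ?thesis
      proof (rule sum_mono)
        fix u assume u: "u \<in> ?C"
        show "(if covered u then 0 else card (nb u)) \<le> 36865 * dis f u"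
        proof (cases "u \<in> ?G")
          case G: True
          have "valid u" using True G by (rule valid_of_dense_cluster)
          moreover have "u \<in> core u" using u cls_subset by (intro self_core) blast
          ultimately show ?thesis by (auto simp: covered_def)
        next
          case False
          then have "?k < 192 * dis f u" using u by simp
          then show ?thesis using deg[OF u] by simp
        qed
      qed
    next
      case False
      have "?k * ?k \<le> (192 * card ?B) * ?k" using False by simp
      also have "\<dots> = 192 * (\<Sum>u\<in>?B. ?k)" by simp
      also have "\<dots> \<le> 192 * (\<Sum>u\<in>?B. 192 * dis f u)"
        by (intro mult_le_mono2 sum_mono) auto
      also have "\<dots> = 36864 * (\<Sum>u\<in>?B. dis f u)" by (simp add: sum_distrib_left)
      also have "(\<Sum>u\<in>?B. dis f u) \<le> (\<Sum>u\<in>?C. dis f u)" by (intro sum_mono2) auto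
      finally have kk: "?k * ?k \<le> 36864 * (\<Sum>u\<in>?C. dis f u)" by simp
      have "(\<Sum>u\<in>?C. if covered u then 0 else card (nb u)) \<le> (\<Sum>u\<in>?C. ?k + dis f u)"
        using deg by (intro sum_mono) auto
      also have "\<dots> = ?k * ?k + (\<Sum>u\<in>?C. dis f u)" by (simp add: sum.distrib)
      also have "\<dots> \<le> 36865 * (\<Sum>u\<in>?C. dis f u)" using kk by simp
      finally show ?thesis by (simp add: sum_distrib_left)
    qed
  qed
  then show ?thesis by (simp add: cost2_eq_sum_dis sum_distrib_left)
qed

section \<open>Pruning an optimal clustering\<close>

definition heavy :: "nat \<Rightarrow> ('a \<Rightarrow> nat) \<Rightarrow> 'a \<Rightarrow> bool" where
  "heavy L f w \<longleftrightarrow> L * card (cls f w) < card (nb w)"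

definition light_cluster :: "nat \<Rightarrow> ('a \<Rightarrow> nat) \<Rightarrow> 'a \<Rightarrow> bool" where
  "light_cluster L f c \<longleftrightarrow> 32 * card {x \<in> cls f c. heavy L f x} \<le> card (cls f c)"

text \<open>Covered vertices stay even in a cluster with many heavy vertices, so that no atom is
  split; what remains of such a cluster consists of covered vertices only, whose pairs are
  atomic.\<close>

definition removed :: "nat \<Rightarrow> ('a \<Rightarrow> nat) \<Rightarrow> 'a \<Rightarrow> bool" where
  "removed L f w \<longleftrightarrow> (if light_cluster L f w then heavy L f w else \<not> covered w)"

text \<open>The degree of a vertex in an atom \<open>K\<close> is at most 17/16 |K|, and the cluster
  contains \<open>K\<close>, so such a vertex is not heavy.\<close>

lemma covered_not_removed:
  assumes "optimal f" "covered w" "2 \<le> L"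
  shows "\<not> removed L f w"
proof -
  obtain K where K: "atom K" "w \<in> K" using assms(2) valid_atom by (auto simp: covered_def)
  have "card (nb w) \<le> card K + card (sym_diff (nb w) K)"
    using atom_finite[OF K(1)] by (intro card_le_card_sym_diff) auto
  also have "\<dots> \<le> 2 * card K" using atom_dis[OF K] by linarith
  also have "card K \<le> card (cls f w)" using atom_subset_cls[OF assms(1) K] by (intro card_mono) auto
  also have "2 * card (cls f w) \<le> L * card (cls f w)" using assms(3) by simp
  finally show ?thesis using assms(2) by (simp add: removed_def heavy_def)
qed

text \<open>A heavy vertex has at least \<open>L - 1\<close> times its cluster size in
  disagreements. Either only heavy vertices are removed, or more than 1/32 of the cluster is heavy;
  hence at most 32 removed vertices are charged to each heavy one.\<close>

lemma sum_removed:
  "(L - 1) * (\<Sum>u\<in>V. if removed L f u then card (cls f u) else 0) \<le> 32 * cost2 f"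
proof -
  have "(\<Sum>u\<in>V. (L - 1) * (if removed L f u then card (cls f u) else 0)) \<le> (\<Sum>u\<in>V. 32 * dis f u)"
  proof (rule sum_by_cluster)
    fix c assume "c \<in> V"
    let ?C = "cls f c" and ?H = "{x \<in> cls f c. heavy L f x}"
    let ?R = "{u \<in> cls f c. removed L f u}"
    have eq: "cls f u = ?C" if "u \<in> ?C" for u using that by (intro cls_eq) (simp add: cls_def)
    have R: "card ?R \<le> 32 * card ?H"
    proof (cases "light_cluster L f c")
      case True
      then have "?R = ?H" using eq by (auto simp: removed_def light_cluster_def)
      then show ?thesis by simp
    next
      case False
      moreover have "card ?R \<le> card ?C" by (intro card_mono) auto
      ultimately show ?thesis by (simp add: light_cluster_def)
    qed
    have "(\<Sum>u\<in>?C. (L - 1) * (if removed L f u then card (cls f u) else 0))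
        = (\<Sum>u\<in>?C. if removed L f u then (L - 1) * card ?C else 0)"
      using eq by (intro sum.cong) auto
    also have "\<dots> = card ?R * ((L - 1) * card ?C)"
      by (simp add: sum.If_cases Int_def)
    also have "\<dots> \<le> (32 * card ?H) * ((L - 1) * card ?C)" using R by (rule mult_le_mono1)
    also have "\<dots> = 32 * (\<Sum>u\<in>?H. (L - 1) * card ?C)" by simp
    also have "\<dots> \<le> 32 * (\<Sum>u\<in>?H. dis f u)"
    proof (intro mult_le_mono2 sum_mono)
      fix u assume u: "u \<in> ?H"
      then have "L * card ?C < card (nb u)" using eq by (auto simp: heavy_def)
      then show "(L - 1) * card ?C \<le> dis f u"
        using card_nb_le[of u f] eq[of u] u by (simp add: diff_mult_distrib)
    qed
    also have "\<dots> \<le> 32 * (\<Sum>u\<in>?C. dis f u)" by (intro mult_le_mono2 sum_mono2) auto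
    finally show "(\<Sum>u\<in>?C. (L - 1) * (if removed L f u then card (cls f u) else 0))
        \<le> (\<Sum>u\<in>?C. 32 * dis f u)" by (simp add: sum_distrib_left)
  qed
  then show ?thesis by (simp add: cost2_eq_sum_dis sum_distrib_left)
qed

text \<open>Isolating a vertex creates at most as many errors as its cluster has members, each seen
  in both orders: this doubles the 32 of \<open>sum_removed\<close>.\<close>

lemma pruned_clustering:
  obtains g where "\<And>u v. u \<in> V \<Longrightarrow> v \<in> V \<Longrightarrow>
      g u = g v \<longleftrightarrow> u = v \<or> f u = f v \<and> \<not> removed L f u \<and> \<not> removed L f v"
    and "(L - 1) * cost2 g \<le> (L - 1) * cost2 f + 64 * cost2 f"
proof -
  obtain h :: "'a \<Rightarrow> nat" where h: "inj_on h V"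
    using finite_imp_inj_to_nat_seg[OF finite_V] by blast
  \<comment> \<open>Removed vertices get distinct even labels and thus become singletons; the odd
    labels preserve the old clusters.\<close>
  define g where "g u = (if removed L f u then 2 * h u else 2 * f u + 1)" for u
  have g: "g u = g v \<longleftrightarrow> u = v \<or> f u = f v \<and> \<not> removed L f u \<and> \<not> removed L f v"
    if "u \<in> V" "v \<in> V" for u v
  proof -
    have "2 * a \<noteq> 2 * b + 1" "2 * b + 1 \<noteq> 2 * a" for a b :: nat by presburger+
    then show ?thesis using inj_on_eq_iff[OF h that] by (auto simp: g_def)
  qed
  let ?r = "\<lambda>u. if removed L f u then card (cls f u) else 0"
  have r: "?r u = (\<Sum>v\<in>V. of_bool (removed L f u \<and> f v = f u))" for u
    by (simp add: cls_def sum_of_bool_card[OF finite_V])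
  have "cost2 g \<le> (\<Sum>u\<in>V. \<Sum>v\<in>V. mis f u v + of_bool (removed L f u \<and> f v = f u)
      + of_bool (removed L f v \<and> f u = f v))"
    unfolding cost2_def using g by (intro sum_mono) (auto simp: mis_def adj_refl)
  also have "\<dots> = cost2 f + (\<Sum>u\<in>V. \<Sum>v\<in>V. of_bool (removed L f u \<and> f v = f u))
      + (\<Sum>u\<in>V. \<Sum>v\<in>V. of_bool (removed L f v \<and> f u = f v))"
    by (simp add: sum.distrib cost2_def)
  also have "(\<Sum>u\<in>V. \<Sum>v\<in>V. of_bool (removed L f v \<and> f u = f v)) = (\<Sum>u\<in>V. ?r u)"
    unfolding r by (rule sum.swap)
  finally have "cost2 g \<le> cost2 f + 2 * (\<Sum>u\<in>V. ?r u)" unfolding r by simp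
  then have "(L - 1) * cost2 g \<le> (L - 1) * (cost2 f + 2 * (\<Sum>u\<in>V. ?r u))" by (rule mult_le_mono2)
  also have "\<dots> = (L - 1) * cost2 f + 2 * ((L - 1) * (\<Sum>u\<in>V. ?r u))" by (simp add: algebra_simps)
  also have "\<dots> \<le> (L - 1) * cost2 f + 64 * cost2 f" using sum_removed[of L f] by simp
  finally show ?thesis using that[of g] g by blast
qed

section \<open>Pairs joined by many short paths\<close>

definition close :: "nat \<Rightarrow> 'a \<Rightarrow> 'a \<Rightarrow> bool" where
  "close M u x \<longleftrightarrow> card (nb x) \<le> M * card (nb u) \<and>
     card (nb u) \<le> M * card {w \<in> V. adj u w \<and> adj x w \<and> card (nb w) \<le> M * card (nb u)}"

text \<open>The second alternative asks for many paths of length 3. All thresholds are relative to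
  the degree of \<open>u\<close>, so the relation is not symmetric and partners can be counted
  against that degree.\<close>

definition near :: "nat \<Rightarrow> 'a \<Rightarrow> 'a \<Rightarrow> bool" where
  "near M u v \<longleftrightarrow> close M u v \<or> card (nb u) \<le> M * card {x \<in> V. adj v x \<and> close M u x}"

text \<open>Count edges between close vertices and the neighbours of \<open>u\<close> of bounded
  degree: with d the degree of \<open>u\<close>, the former have at least d/M each, the latter at
  most d vertices of degree at most M d.\<close>

lemma card_close_le:
  assumes "u \<in> V"
  shows "card {x \<in> V. close M u x} \<le> M\<^sup>2 * card (nb u)"
proof -
  let ?d = "card (nb u)" and ?X = "{x \<in> V. close M u x}"
  let ?W = "{w \<in> nb u. card (nb w) \<le> M * card (nb u)}"
  have "card ?X * ?d = (\<Sum>x\<in>?X. ?d)" by simp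
  also have "\<dots> \<le> (\<Sum>x\<in>?X. M * card {w \<in> ?W. adj x w})"
  proof (rule sum_mono)
    fix x assume "x \<in> ?X"
    moreover have "{w \<in> V. adj u w \<and> adj x w \<and> card (nb w) \<le> M * card (nb u)} = {w \<in> ?W. adj x w}"
      by (auto simp: nb_def)
    ultimately show "?d \<le> M * card {w \<in> ?W. adj x w}" by (auto simp: close_def)
  qed
  also have "\<dots> = M * (\<Sum>x\<in>?X. card {w \<in> ?W. adj x w})" by (simp add: sum_distrib_left)
  also have "(\<Sum>x\<in>?X. card {w \<in> ?W. adj x w}) = (\<Sum>w\<in>?W. card {x \<in> ?X. adj x w})"
    using finite_V by (intro sum_card_Collect_swap) auto
  also have "\<dots> \<le> (\<Sum>w\<in>?W. M * ?d)"
  proof (rule sum_mono)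
    fix w assume w: "w \<in> ?W"
    have "card {x \<in> ?X. adj x w} \<le> card (nb w)"
      by (intro card_mono) (auto simp: nb_def finite_V intro: adj_sym)
    also have "\<dots> \<le> M * ?d" using w by simp
    finally show "card {x \<in> ?X. adj x w} \<le> M * ?d" .
  qed
  also have "\<dots> \<le> ?d * (M * ?d)" by (auto intro!: card_mono)
  finally have "card ?X * ?d \<le> (M\<^sup>2 * ?d) * ?d" by (simp add: power2_eq_square algebra_simps)
  then show ?thesis using card_nb_pos[OF assms] by simp
qed

text \<open>The same count again, now with the at most M^2 d close vertices as the middle layer,
  yields M^4 d for the paths of length 3.\<close>

lemma card_near_le:
  assumes "u \<in> V"
  shows "card {v \<in> V. near M u v} \<le> 2 * M ^ 4 * card (nb u)"
proof -
  let ?d = "card (nb u)" and ?X = "{x \<in> V. close M u x}"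
  let ?Y = "{v \<in> V. card (nb u) \<le> M * card {x \<in> V. adj v x \<and> close M u x}}"
  have "card ?Y * ?d = (\<Sum>v\<in>?Y. ?d)" by simp
  also have "\<dots> \<le> (\<Sum>v\<in>?Y. M * card {x \<in> ?X. adj v x})"
  proof (rule sum_mono)
    fix v assume "v \<in> ?Y"
    moreover have "{x \<in> V. adj v x \<and> close M u x} = {x \<in> ?X. adj v x}" by auto
    ultimately show "?d \<le> M * card {x \<in> ?X. adj v x}" by simp
  qed
  also have "\<dots> = M * (\<Sum>v\<in>?Y. card {x \<in> ?X. adj v x})" by (simp add: sum_distrib_left)
  also have "(\<Sum>v\<in>?Y. card {x \<in> ?X. adj v x}) = (\<Sum>x\<in>?X. card {v \<in> ?Y. adj v x})"
    using finite_V by (intro sum_card_Collect_swap) auto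
  also have "\<dots> \<le> (\<Sum>x\<in>?X. M * ?d)"
  proof (rule sum_mono)
    fix x assume x: "x \<in> ?X"
    have "card {v \<in> ?Y. adj v x} \<le> card (nb x)"
      by (intro card_mono) (auto simp: nb_def finite_V intro: adj_sym)
    also have "\<dots> \<le> M * ?d" using x by (simp add: close_def)
    finally show "card {v \<in> ?Y. adj v x} \<le> M * ?d" .
  qed
  also have "\<dots> = card ?X * (M * ?d)" by simp
  also have "\<dots> \<le> (M\<^sup>2 * ?d) * (M * ?d)" using card_close_le[OF assms] by (rule mult_le_mono1)
  finally have "card ?Y * ?d \<le> (M ^ 4 * ?d) * ?d"
    by (simp add: power2_eq_square power4_eq_xxxx algebra_simps)
  then have Y: "card ?Y \<le> M ^ 4 * ?d" using card_nb_pos[OF assms] by simp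
  have "M\<^sup>2 \<le> M ^ 4" by (cases "M = 0") (auto intro: power_increasing)
  then have X: "card ?X \<le> M ^ 4 * ?d"
    using card_close_le[OF assms, of M] by (meson le_trans mult_le_mono1)
  have "card {v \<in> V. near M u v} \<le> card (?X \<union> ?Y)"
    using finite_V by (intro card_mono) (auto simp: near_def)
  also have "\<dots> \<le> card ?X + card ?Y" by (rule card_Un_le)
  finally show ?thesis using X Y by simp
qed

text \<open>Both \<open>u\<close> and \<open>v\<close> are adjacent to at least half of the cluster.
  If these halves overlap substantially, common neighbours suffice. Otherwise they almost partition
  the cluster, and the cut between them carries enough edges to give many paths of length 3. Heavy
  vertices are few enough to be avoided.\<close>

lemma near_of_light_cluster:
  assumes opt: "optimal f" and V: "u \<in> V" "v \<in> V" and eq: "f u = f v"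
    and u: "\<not> heavy L f u" and v: "\<not> heavy L f v" and light: "light_cluster L f u"
    and M: "64 * L \<le> M"
  shows "near M u v"
proof -
  let ?C = "cls f u" and ?H = "{x \<in> cls f u. heavy L f x}"
  let ?k = "card ?C" and ?d = "card (nb u)"
  let ?A = "nb u \<inter> ?C" and ?B = "nb v \<inter> ?C"
  have clsv: "cls f v = ?C" using eq cls_eq[of f v u] by simp
  have H: "32 * card ?H \<le> ?k" using light by (simp add: light_cluster_def)
  have A: "?k \<le> 2 * card ?A" by (rule optimal_degree[OF opt V(1)])
  have B: "?k \<le> 2 * card ?B" using optimal_degree[OF opt V(2)] clsv by simp
  have d_le: "?d \<le> L * ?k" using u by (simp add: heavy_def)
  have "card ?A \<le> ?d" by (intro card_mono) auto
  then have k_le: "?k \<le> 2 * ?d" using A by simp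
  have deg: "card (nb x) \<le> M * ?d" if "x \<in> ?C" "x \<notin> ?H" for x
  proof -
    have "cls f x = ?C" using that by (intro cls_eq) (simp add: cls_def)
    then have "card (nb x) \<le> L * ?k" using that by (simp add: heavy_def)
    also have "\<dots> \<le> L * (2 * ?d)" using k_le by (rule mult_le_mono2)
    also have "\<dots> = (2 * L) * ?d" by simp
    also have "\<dots> \<le> M * ?d" using M by (intro mult_le_mono1) simp
    finally show ?thesis .
  qed
  \<comment> \<open>A constant fraction of the cluster is a fraction 1/M of the degree of
    \<open>u\<close>, because \<open>u\<close> is not heavy.\<close>
  have enough: "?d \<le> M * a" if "?k \<le> 64 * a" for a
  proof -
    have "?d \<le> L * (64 * a)" using d_le mult_le_mono2[OF that, of L] by (rule le_trans)
    also have "\<dots> = (64 * L) * a" by simp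
    also have "\<dots> \<le> M * a" using M by (rule mult_le_mono1)
    finally show ?thesis .
  qed
  have finH: "finite ?H" by simp
  show ?thesis
  proof (cases "?k \<le> 16 * card (?A \<inter> ?B)")
    case True
    let ?W = "{w \<in> V. adj u w \<and> adj v w \<and> card (nb w) \<le> M * ?d}"
    have "card (?A \<inter> ?B) \<le> card (?W \<union> ?H)"
      using deg finite_V by (intro card_mono) (auto simp: nb_def)
    also have "\<dots> \<le> card ?W + card ?H" by (rule card_Un_le)
    finally have "?k \<le> 64 * card ?W" using True H by linarith
    then have "?d \<le> M * card ?W" by (rule enough)
    moreover have "card (nb v) \<le> M * ?d" using v V eq by (intro deg) (auto simp: cls_def)
    ultimately show ?thesis by (simp add: near_def close_def)
  next
    case False
    let ?S = "?A - ?B" and ?B' = "?B - ?H"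
    let ?T = "?C - ?S"
    let ?c = "\<lambda>x. card {a \<in> ?S - ?H. adj a x}"
    let ?X = "{x \<in> ?B'. ?k \<le> 64 * ?c x}"
    have k_pos: "0 < ?k" using V card_cls_pos by simp
    have SA: "card ?A = card ?S + card (?A \<inter> ?B)"
      using card_Int_Diff[of ?A ?B] by simp
    have S: "7 * ?k \<le> 16 * card ?S" using SA A False by linarith
    have TB: "card ?T = card ?B + card (?T - ?B)"
    proof -
      have "?T \<inter> ?B = ?B" by auto
      then show ?thesis using card_Int_Diff[of ?T ?B] by simp
    qed
    have "?k = card ?S + card ?T"
    proof -
      have "?C \<inter> ?S = ?S" by auto
      then show ?thesis using card_Int_Diff[of ?C ?S] by simp
    qed
    \<comment> \<open>\<open>?S\<close> has at least 7/16 of the cluster and \<open>?B\<close> at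
      least 8/16, so at most 1/16 belongs to neither.\<close>
    then have T_B: "16 * card (?T - ?B) \<le> ?k" using SA TB A B False by linarith
    have T: "?k \<le> 2 * card ?T" using TB B by linarith
    have nbT: "32 * card (nb a \<inter> ?T) \<le> 32 * card {x \<in> ?B'. adj a x} + 3 * ?k" for a
    proof -
      have "card (nb a \<inter> ?T) \<le> card ({x \<in> ?B'. adj a x} \<union> ((?T - ?B) \<union> ?H))"
        by (intro card_mono) (auto simp: nb_def[of a])
      also have "\<dots> \<le> card {x \<in> ?B'. adj a x} + card ((?T - ?B) \<union> ?H)" by (rule card_Un_le)
      also have "card ((?T - ?B) \<union> ?H) \<le> card (?T - ?B) + card ?H" by (rule card_Un_le)
      finally show ?thesis using T_B H by linarith
    qed
    let ?e = "\<Sum>a\<in>?S. card {x \<in> ?B'. adj a x}"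
    have "card ?S * card ?T \<le> 2 * (\<Sum>a\<in>?S. card (nb a \<inter> ?T))"
      by (rule optimal_cut[OF opt]) auto
    then have "16 * (card ?S * card ?T) \<le> (\<Sum>a\<in>?S. 32 * card (nb a \<inter> ?T))"
      unfolding sum_distrib_left[symmetric] by linarith
    also have "\<dots> \<le> (\<Sum>a\<in>?S. 32 * card {x \<in> ?B'. adj a x} + 3 * ?k)"
      using nbT by (rule sum_mono)
    also have "\<dots> = 32 * ?e + 3 * (card ?S * ?k)"
      by (simp add: sum.distrib sum_distrib_left)
    finally have "16 * (card ?S * card ?T) \<le> 32 * ?e + 3 * (card ?S * ?k)" .
    moreover have "card ?S * ?k \<le> 2 * (card ?S * card ?T)" using mult_le_mono2[OF T, of "card ?S"] by simp
    ultimately have "5 * (card ?S * ?k) \<le> 32 * ?e" by linarith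
    moreover have "7 * (?k * ?k) \<le> 16 * (card ?S * ?k)" using mult_le_mono1[OF S, of ?k] by simp
    ultimately have e: "35 * (?k * ?k) \<le> 512 * ?e" by linarith
    have "?e = (\<Sum>x\<in>?B'. card {a \<in> ?S. adj a x})"
      by (intro sum_card_Collect_swap) auto
    also have "\<dots> \<le> (\<Sum>x\<in>?B'. ?c x + card ?H)"
    proof (rule sum_mono)
      fix x
      have "card {a \<in> ?S. adj a x} \<le> card ({a \<in> ?S - ?H. adj a x} \<union> ?H)"
        by (intro card_mono) auto
      then show "card {a \<in> ?S. adj a x} \<le> ?c x + card ?H" using card_Un_le le_trans by blast
    qed
    also have "\<dots> = (\<Sum>x\<in>?B'. ?c x) + card ?B' * card ?H" by (simp add: sum.distrib)
    finally have e1: "?e \<le> (\<Sum>x\<in>?B'. ?c x) + card ?B' * card ?H" .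
    have B'k: "card ?B' \<le> ?k" by (intro card_mono) auto
    have BH: "32 * (card ?B' * card ?H) \<le> ?k * ?k" using mult_le_mono[OF B'k H] by simp
    have "(\<Sum>x\<in>?B'. 64 * ?c x) \<le> (\<Sum>x\<in>?B'. ?k + (if x \<in> ?X then 64 * ?k else 0))"
    proof (rule sum_mono)
      fix x assume "x \<in> ?B'"
      moreover have "?c x \<le> ?k" by (intro card_mono) auto
      ultimately show "64 * ?c x \<le> ?k + (if x \<in> ?X then 64 * ?k else 0)" by auto
    qed
    also have "\<dots> = card ?B' * ?k + (\<Sum>x\<in>?B'. if x \<in> ?X then 64 * ?k else 0)"
      by (simp only: sum.distrib) simp
    also have "(\<Sum>x\<in>?B'. if x \<in> ?X then 64 * ?k else 0) = (\<Sum>x\<in>?B' \<inter> ?X. 64 * ?k)"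
      by (rule sum.inter_restrict[symmetric]) simp
    also have "?B' \<inter> ?X = ?X" by auto
    also have "(\<Sum>x\<in>?X. 64 * ?k) = 64 * (card ?X * ?k)" by simp
    also have "card ?B' * ?k \<le> ?k * ?k" using B'k by (rule mult_le_mono1)
    finally have "64 * (\<Sum>x\<in>?B'. ?c x) \<le> ?k * ?k + 64 * (card ?X * ?k)"
      by (simp only: sum_distrib_left)
    \<comment> \<open>In units of k^2/512: the cut supplies at least 35, heavy vertices in
      \<open>?S\<close> absorb at most 16, and vertices of \<open>?B'\<close> with few such
      neighbours at most 8. The remaining 11 come from \<open>?X\<close>.\<close>
    with e e1 BH have "11 * (?k * ?k) \<le> 512 * (card ?X * ?k)" by linarith
    then have "(11 * ?k) * ?k \<le> (512 * card ?X) * ?k" by (simp only: mult.assoc)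
    then have "11 * ?k \<le> 512 * card ?X" using k_pos by (simp only: mult_le_cancel2)
    then have X: "?k \<le> 64 * card ?X" by linarith
    have "close M u x" if x: "x \<in> ?X" for x
    proof -
      have "?c x \<le> card {w \<in> V. adj u w \<and> adj x w \<and> card (nb w) \<le> M * ?d}"
        using deg finite_V adj_sym by (intro card_mono) (auto simp: nb_def)
      with x have "?k \<le> 64 * card {w \<in> V. adj u w \<and> adj x w \<and> card (nb w) \<le> M * ?d}"
        by simp
      then have "?d \<le> M * card {w \<in> V. adj u w \<and> adj x w \<and> card (nb w) \<le> M * ?d}"
        by (rule enough)
      moreover have "card (nb x) \<le> M * ?d" using x by (intro deg) auto
      ultimately show ?thesis by (simp add: close_def)
    qed
    then have "card ?X \<le> card {x \<in> V. adj v x \<and> close M u x}"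
      using finite_V by (intro card_mono) (auto simp: nb_def)
    then have "?k \<le> 64 * card {x \<in> V. adj v x \<and> close M u x}" using X by linarith
    then show ?thesis using enough by (simp add: near_def)
  qed
qed

end

section \<open>The preclustering algorithm\<close>

definition holds :: "nat \<Rightarrow> (nat \<Rightarrow> nat) \<Rightarrow> aexp \<Rightarrow> (nat \<Rightarrow> nat) \<Rightarrow> bool" where
  "holds n a e \<rho> \<longleftrightarrow> eval n a e \<rho> \<noteq> 0"

text \<open>Any nonzero value is true. Truncated subtraction supplies negation and comparison, and a
  sum is an existential quantifier; double negation normalises to 0 or 1, after which a sum
  counts.\<close>

definition notE :: "aexp \<Rightarrow> aexp" where "notE e = Minus (Num 1) e"
definition orE :: "aexp \<Rightarrow> aexp \<Rightarrow> aexp" where "orE e f = Plus e f"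
definition andE :: "aexp \<Rightarrow> aexp \<Rightarrow> aexp" where "andE e f = notE (orE (notE e) (notE f))"
definition xorE :: "aexp \<Rightarrow> aexp \<Rightarrow> aexp" where "xorE e f = orE (andE e (notE f)) (andE (notE e) f)"
definition leE :: "aexp \<Rightarrow> aexp \<Rightarrow> aexp" where "leE e f = notE (Minus e f)"
definition exE :: "nat \<Rightarrow> aexp \<Rightarrow> aexp" where "exE x e = Sum x e"
definition allE :: "nat \<Rightarrow> aexp \<Rightarrow> aexp" where "allE x e = notE (exE x (notE e))"
definition countE :: "nat \<Rightarrow> aexp \<Rightarrow> aexp" where "countE x e = Sum x (notE (notE e))"

primrec timesE :: "nat \<Rightarrow> aexp \<Rightarrow> aexp" where
  "timesE 0 e = Num 0"
| "timesE (Suc k) e = Plus e (timesE k e)"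

lemma holds_simps [simp]:
  "holds n a (notE e) \<rho> \<longleftrightarrow> \<not> holds n a e \<rho>"
  "holds n a (orE e f) \<rho> \<longleftrightarrow> holds n a e \<rho> \<or> holds n a f \<rho>"
  "holds n a (andE e f) \<rho> \<longleftrightarrow> holds n a e \<rho> \<and> holds n a f \<rho>"
  "holds n a (xorE e f) \<rho> \<longleftrightarrow> holds n a e \<rho> \<noteq> holds n a f \<rho>"
  "holds n a (leE e f) \<rho> \<longleftrightarrow> eval n a e \<rho> \<le> eval n a f \<rho>"
  "holds n a (exE x e) \<rho> \<longleftrightarrow> (\<exists>k<n. holds n a e (\<rho>(x := k)))"
  by (auto simp: holds_def notE_def orE_def andE_def xorE_def leE_def exE_def)

lemma holds_allE [simp]: "holds n a (allE x e) \<rho> \<longleftrightarrow> (\<forall>k<n. holds n a e (\<rho>(x := k)))"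
  by (simp add: allE_def)

lemma eval_timesE [simp]: "eval n a (timesE k e) \<rho> = k * eval n a e \<rho>"
  by (induction k) auto

lemma eval_notE_notE: "eval n a (notE (notE e)) \<rho> = of_bool (holds n a e \<rho>)"
  by (simp add: holds_def notE_def)

lemma eval_countE [simp]: "eval n a (countE x e) \<rho> = card {k. k < n \<and> holds n a e (\<rho>(x := k))}"
proof -
  have "eval n a (countE x e) \<rho> = (\<Sum>k<n. if holds n a e (\<rho>(x := k)) then 1 else 0)"
    unfolding countE_def by (auto simp: holds_def notE_def intro!: sum.cong)
  also have "\<dots> = card ({..<n} \<inter> {k. holds n a e (\<rho>(x := k))})"
    by (simp add: sum.If_cases)
  also have "{..<n} \<inter> {k. holds n a e (\<rho>(x := k))} = {k. k < n \<and> holds n a e (\<rho>(x := k))}" by auto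
  finally show ?thesis .
qed

text \<open>Bound variables are numbered downwards from the innermost one, so that an expression with
  bound variables from \<open>x\<close> on may be applied to all variables below \<open>x\<close>.\<close>

definition adjE :: "nat \<Rightarrow> nat \<Rightarrow> aexp" where
  "adjE u v = orE (andE (leE (Var u) (Var v)) (leE (Var v) (Var u)))
     (Inp (Plus (Sum 20 (Var u)) (Var v)))"

definition degE :: "nat \<Rightarrow> aexp" where "degE u = countE 19 (adjE u 19)"

definition coreE :: "nat \<Rightarrow> nat \<Rightarrow> aexp" where
  "coreE u v = leE (timesE 64 (countE 18 (xorE (adjE u 18) (adjE v 18)))) (degE u)"

definition validE :: "nat \<Rightarrow> aexp" where
  "validE u = allE 17 (orE (notE (coreE u 17))
     (leE (timesE 16 (countE 16 (xorE (adjE 17 16) (coreE u 16)))) (countE 16 (coreE u 16))))"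

definition coveredE :: "nat \<Rightarrow> aexp" where
  "coveredE v = exE 15 (andE (validE 15) (coreE 15 v))"

definition linkedE :: "nat \<Rightarrow> nat \<Rightarrow> aexp" where
  "linkedE y v = exE 14 (andE (andE (validE 14) (coreE 14 y))
     (exE 13 (andE (andE (validE 13) (coreE 13 v)) (exE 12 (andE (coreE 14 12) (coreE 13 12))))))"

text \<open>A maximum expressed by counting: the numbers at or below some linked vertex are those
  from 0 to the largest one. The value 0 stays reserved for uncovered vertices.\<close>

definition labelE :: "nat \<Rightarrow> aexp" where
  "labelE v = countE 11 (exE 10 (andE (leE (Var 11) (Var 10)) (linkedE 10 v)))"

definition closeE :: "nat \<Rightarrow> nat \<Rightarrow> nat \<Rightarrow> aexp" where
  "closeE M u x = andE (leE (degE x) (timesE M (degE u)))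
     (leE (degE u) (timesE M (countE 9 (andE (adjE u 9) (andE (adjE x 9)
       (leE (degE 9) (timesE M (degE u))))))))"

definition nearE :: "nat \<Rightarrow> nat \<Rightarrow> nat \<Rightarrow> aexp" where
  "nearE M u v = orE (closeE M u v)
     (leE (degE u) (timesE M (countE 8 (andE (adjE v 8) (closeE M u 8)))))"

definition admissibleE :: "nat \<Rightarrow> nat \<Rightarrow> nat \<Rightarrow> aexp" where
  "admissibleE M u v = orE (andE (notE (coveredE u)) (nearE M u v)) (andE (notE (coveredE v)) (nearE M v u))"

text \<open>The diagonal is excluded because the input matrix is zero there, while
  \<open>adj\<close> is reflexive.\<close>

locale matrix_graph = refl_graph "{..<n}" adj for n :: nat and adj +
  fixes a :: "nat \<Rightarrow> nat"
  assumes matrix: "u < n \<Longrightarrow> v < n \<Longrightarrow> u \<noteq> v \<Longrightarrow> a (u * n + v) \<noteq> 0 \<longleftrightarrow> adj u v"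
begin

lemma nb_Collect: "nb u = {v. v < n \<and> adj u v}"
  by (auto simp: nb_def)

lemma holds_adjE [simp]:
  "u < 20 \<Longrightarrow> v < 20 \<Longrightarrow> \<rho> u < n \<Longrightarrow> \<rho> v < n \<Longrightarrow> holds n a (adjE u v) \<rho> \<longleftrightarrow> adj (\<rho> u) (\<rho> v)"
  using matrix[of "\<rho> u" "\<rho> v"] adj_refl[of "\<rho> u"]
  by (cases "\<rho> u = \<rho> v") (auto simp: adjE_def holds_def[of n a "Inp e" for e] mult.commute[of n])

lemma eval_degE [simp]: "u < 19 \<Longrightarrow> \<rho> u < n \<Longrightarrow> eval n a (degE u) \<rho> = card (nb (\<rho> u))"
  by (simp add: degE_def nb_Collect cong: conj_cong)

lemma holds_coreE [simp]:
  assumes "u < 18" "v < 18" "\<rho> u < n" "\<rho> v < n"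
  shows "holds n a (coreE u v) \<rho> \<longleftrightarrow> \<rho> v \<in> core (\<rho> u)"
proof -
  have "{k. k < n \<and> adj (\<rho> u) k = (\<not> adj (\<rho> v) k)} = sym_diff (nb (\<rho> u)) (nb (\<rho> v))"
    by (auto simp: nb_def)
  with assms show ?thesis by (simp add: coreE_def core_def cong: conj_cong)
qed

lemma holds_validE [simp]:
  assumes "u < 16" "\<rho> u < n"
  shows "holds n a (validE u) \<rho> \<longleftrightarrow> valid (\<rho> u)"
proof -
  have "{k. k < n \<and> adj v k = (k \<notin> core (\<rho> u))} = sym_diff (nb v) (core (\<rho> u))" for v
    using core_subset by (auto simp: nb_def)
  moreover have "{k. k < n \<and> k \<in> core (\<rho> u)} = core (\<rho> u)" using core_subset by auto
  moreover have "(\<forall>k<n. k \<in> core (\<rho> u) \<longrightarrow> P k) \<longleftrightarrow> (\<forall>k\<in>core (\<rho> u). P k)" for P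
    using core_subset by auto
  ultimately show ?thesis using assms
    by (simp add: validE_def valid_def imp_conv_disj[symmetric] cong: conj_cong imp_cong)
qed

lemma valid_less: "valid u \<Longrightarrow> u < n"
  by (simp add: valid_def)

lemma holds_coveredE [simp]:
  "v < 15 \<Longrightarrow> \<rho> v < n \<Longrightarrow> holds n a (coveredE v) \<rho> \<longleftrightarrow> covered (\<rho> v)"
  by (simp add: coveredE_def covered_def cong: conj_cong) (blast dest: valid_less)

lemma holds_linkedE [simp]:
  assumes "y < 12" "v < 12" "\<rho> y < n" "\<rho> v < n"
  shows "holds n a (linkedE y v) \<rho> \<longleftrightarrow> linked (\<rho> y) (\<rho> v)"
proof -
  have "(\<exists>k<n. k \<in> core u \<and> k \<in> core w) \<longleftrightarrow> core u \<inter> core w \<noteq> {}" for u w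
    using core_subset by blast
  with assms show ?thesis
    by (simp add: linkedE_def linked_def cong: conj_cong) (blast dest: valid_less)
qed

definition label :: "nat \<Rightarrow> nat" where
  "label v = card {x. x < n \<and> (\<exists>y<n. x \<le> y \<and> linked y v)}"

lemma eval_labelE [simp]: "v < 10 \<Longrightarrow> \<rho> v < n \<Longrightarrow> eval n a (labelE v) \<rho> = label (\<rho> v)"
  by (simp add: labelE_def label_def cong: conj_cong)

lemma holds_closeE [simp]:
  "u < 9 \<Longrightarrow> x < 9 \<Longrightarrow> \<rho> u < n \<Longrightarrow> \<rho> x < n \<Longrightarrow> holds n a (closeE M u x) \<rho> \<longleftrightarrow> close M (\<rho> u) (\<rho> x)"
  by (simp add: closeE_def close_def cong: conj_cong)

lemma holds_nearE [simp]:
  "u < 8 \<Longrightarrow> v < 8 \<Longrightarrow> \<rho> u < n \<Longrightarrow> \<rho> v < n \<Longrightarrow> holds n a (nearE M u v) \<rho> \<longleftrightarrow> near M (\<rho> u) (\<rho> v)"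
  by (simp add: nearE_def near_def cong: conj_cong)

text \<open>Nearness is measured from an uncovered end. This ensures that no admissible pair joins
  two atom vertices, and lets the pairs be charged to the degrees of uncovered vertices.\<close>

definition admissible :: "nat \<Rightarrow> nat \<Rightarrow> nat \<Rightarrow> bool" where
  "admissible M u v \<longleftrightarrow> \<not> covered u \<and> near M u v \<or> \<not> covered v \<and> near M v u"

lemma holds_admissibleE:
  "u < 8 \<Longrightarrow> v < 8 \<Longrightarrow> \<rho> u < n \<Longrightarrow> \<rho> v < n \<Longrightarrow>
    holds n a (admissibleE M u v) \<rho> \<longleftrightarrow> admissible M (\<rho> u) (\<rho> v)"
  by (simp add: admissibleE_def admissible_def)

text \<open>The label of a covered vertex is one more than the largest vertex linked to it.\<close>

lemma label_eq:
  assumes "optimal f" "covered v"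
  obtains m where "linked m v" "label v = Suc m"
proof -
  let ?Y = "{y. linked y v}"
  have cov: "y < n" if "covered y" for y using covered_in_V[OF that] by simp
  have Y: "?Y \<subseteq> {..<n}" using cov linked_iff[OF assms(1)] by auto
  then have fin: "finite ?Y" using finite_subset by blast
  have v: "v \<in> ?Y" using linked_iff[OF assms(1)] assms(2) by auto
  define m where "m = Max ?Y"
  have m: "m \<in> ?Y" unfolding m_def using fin v by (intro Max_in) auto
  have "{x. x < n \<and> (\<exists>y<n. x \<le> y \<and> linked y v)} = {..m}"
  proof
    show "{x. x < n \<and> (\<exists>y<n. x \<le> y \<and> linked y v)} \<subseteq> {..m}"
      using Max_ge[OF fin] unfolding m_def[symmetric] by (auto intro: order_trans)
    show "{..m} \<subseteq> {x. x < n \<and> (\<exists>y<n. x \<le> y \<and> linked y v)}"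
      using m Y by auto
  qed
  then have "label v = Suc m" by (simp add: label_def)
  then show ?thesis using that m by blast
qed

lemma label_nonzero_iff:
  assumes "optimal f" "v < n"
  shows "label v \<noteq> 0 \<longleftrightarrow> covered v"
proof
  assume "label v \<noteq> 0"
  then have "{x. x < n \<and> (\<exists>y<n. x \<le> y \<and> linked y v)} \<noteq> {}" unfolding label_def by (metis card.empty)
  then show "covered v" using linked_iff[OF assms(1)] by auto
next
  assume "covered v"
  then show "label v \<noteq> 0" using label_eq[OF assms(1)] by (metis nat.distinct(2))
qed

text \<open>Equal labels mean the same largest linked vertex, which shares a cluster with both. Each
  output atom thus consists of all covered vertices of one optimal cluster.\<close>

lemma label_eq_iff:
  assumes "optimal f" "covered u" "covered v"
  shows "label u = label v \<longleftrightarrow> f u = f v"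
proof
  assume eq: "f u = f v"
  then have "linked y u \<longleftrightarrow> linked y v" for y using linked_iff[OF assms(1)] assms(2,3) by simp
  then show "label u = label v" by (simp add: label_def)
next
  assume eq: "label u = label v"
  obtain m where "linked m u" "label u = Suc m" using label_eq[OF assms(1,2)] .
  moreover obtain m' where "linked m' v" "label v = Suc m'" using label_eq[OF assms(1,3)] .
  ultimately show "f u = f v" using eq linked_iff[OF assms(1)] by simp
qed

end

section \<open>From labellings of indices to partitions of vertices\<close>

lemma card_index_pairs:
  assumes vs: "distinct vs" and E: "E \<subseteq> pairs (set vs)"
  shows "card {(i, j). i < length vs \<and> j < length vs \<and> {vs ! i, vs ! j} \<in> E} = 2 * card E"
proof -
  let ?n = "length vs" and ?I = "\<lambda>e. {(i, j). i < length vs \<and> j < length vs \<and> {vs ! i, vs ! j} = e}"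
  have "pairs (set vs) \<subseteq> Pow (set vs)" by (auto simp: pairs_def)
  then have finE: "finite E" using E finite_subset by (metis List.finite_set finite_Pow_iff)
  have finI: "finite (?I e)" for e
    by (rule finite_subset[of _ "{..<?n} \<times> {..<?n}"]) auto
  have two: "card (?I e) = 2" if "e \<in> E" for e
  proof -
    from that E obtain u v where uv: "e = {u, v}" "u \<in> set vs" "v \<in> set vs" "u \<noteq> v"
      by (auto simp: pairs_def)
    then obtain i j where ij: "i < ?n" "j < ?n" "u = vs ! i" "v = vs ! j" by (metis in_set_conv_nth)
    have "?I e = {(i, j), (j, i)}"
      using ij uv vs by (auto simp: doubleton_eq_iff nth_eq_iff_index_eq)
    moreover have "i \<noteq> j" using ij uv by auto
    ultimately show ?thesis by simp
  qed
  have "{(i, j). i < ?n \<and> j < ?n \<and> {vs ! i, vs ! j} \<in> E} = (\<Union>e\<in>E. ?I e)" by auto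
  then have "card {(i, j). i < ?n \<and> j < ?n \<and> {vs ! i, vs ! j} \<in> E} = (\<Sum>e\<in>E. card (?I e))"
    using finE finI by (simp only:) (rule card_UN_disjoint, auto)
  also have "\<dots> = 2 * card E" using two by simp
  finally show ?thesis .
qed

lemma partition_on_fibres:
  "partition_on (set vs) {{vs ! j | j. j < length vs \<and> f j = f i} | i. i < length vs}"
  if "distinct vs"
proof (rule partition_onI)
  show "\<Union>{{vs ! j | j. j < length vs \<and> f j = f i} | i. i < length vs} = set vs"
  proof (intro equalityI subsetI)
    fix x assume "x \<in> set vs"
    then obtain i where "i < length vs" "x = vs ! i" by (auto simp: in_set_conv_nth)
    then show "x \<in> \<Union>{{vs ! j | j. j < length vs \<and> f j = f i} | i. i < length vs}" by blast
  qed auto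
qed (use that in \<open>auto simp: disjnt_def nth_eq_iff_index_eq\<close>)

lemma together_fibres:
  assumes "distinct vs" "i < length vs" "j < length vs"
  shows "together {{vs ! j | j. j < length vs \<and> f j = f i} | i. i < length vs} {vs ! i, vs ! j}
    \<longleftrightarrow> f i = f j"
proof
  assume "f i = f j"
  then have "{vs ! i, vs ! j} \<subseteq> {vs ! l | l. l < length vs \<and> f l = f i}" using assms by auto
  then show "together {{vs ! j | j. j < length vs \<and> f j = f i} | i. i < length vs} {vs ! i, vs ! j}"
    unfolding together_def using assms(2) by blast
qed (use assms in \<open>auto simp: together_def nth_eq_iff_index_eq\<close>)

text \<open>The label of an index is the number of its block under an injective numbering of the
  finitely many blocks.\<close>

lemma partition_on_labelling:
  assumes "partition_on (set vs) P"
  shows "\<exists>f :: nat \<Rightarrow> nat. \<forall>i<length vs. \<forall>j<length vs. together P {vs ! i, vs ! j} \<longleftrightarrow> f i = f j"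
proof -
  have "P \<subseteq> Pow (set vs)" using partition_onD1[OF assms] by auto
  then have "finite P" by (metis List.finite_set finite_Pow_iff finite_subset)
  then obtain h :: "'a set \<Rightarrow> nat" where h: "inj_on h P"
    using finite_imp_inj_to_nat_seg by blast
  define B where "B x = (THE b. b \<in> P \<and> x \<in> b)" for x
  have uniq: "b = c" if "b \<in> P" "c \<in> P" "x \<in> b" "x \<in> c" for b c x
    using partition_onD2[OF assms] that by (auto simp: disjoint_def)
  have B: "B x \<in> P \<and> x \<in> B x" if "x \<in> set vs" for x
  proof -
    obtain b where b: "b \<in> P" "x \<in> b" using \<open>x \<in> set vs\<close> partition_onD1[OF assms] by auto
    then have "B x = b" unfolding B_def using uniq by (intro the_equality) auto
    with b show ?thesis by simp
  qed
  have "together P {x, y} \<longleftrightarrow> h (B x) = h (B y)" if "x \<in> set vs" "y \<in> set vs" for x y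
    using B[OF that(1)] B[OF that(2)] inj_on_eq_iff[OF h] uniq unfolding together_def
    by (metis empty_subsetI insert_subset)
  then show ?thesis by (intro exI[of _ "\<lambda>i. h (B (vs ! i))"]) simp
qed

locale indexed_instance =
  fixes V :: "'a set" and Ep Em vs
  assumes inst: "cc_instance V Ep Em" and distinct_vs: "distinct vs" and set_vs: "set vs = V"
begin

abbreviation n where "n \<equiv> length vs"

definition edge :: "nat \<Rightarrow> nat \<Rightarrow> bool" where
  "edge i j \<longleftrightarrow> i = j \<or> {vs ! i, vs ! j} \<in> Ep"

sublocale matrix_graph n edge "snd (input_state vs Ep) 0"
proof
  fix u v assume uv: "u < n" "v < n" "u \<noteq> v"
  have "u * n + v < n * n"
  proof -
    have "u * n + v < Suc u * n" using uv(2) by simp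
    also have "\<dots> \<le> n * n" using uv(1) by (intro mult_le_mono1) simp
    finally show ?thesis .
  qed
  moreover have "(u * n + v) div n = u" "(u * n + v) mod n = v" using uv(2) by (simp_all add: mult_add_div_mod)
  ultimately show "snd (input_state vs Ep) 0 (u * n + v) \<noteq> 0 \<longleftrightarrow> edge u v"
    using uv by (simp add: input_state_def Let_def edge_def)
qed (auto simp: edge_def insert_commute)

lemma fst_input_state: "fst (input_state vs Ep) 0 = n"
  by (simp add: input_state_def Let_def)

lemma edges: "Ep \<union> Em = pairs (set vs)" "Ep \<inter> Em = {}"
  using inst set_vs by (auto simp: cc_instance_def)

lemma nth_pairs: "i < n \<Longrightarrow> j < n \<Longrightarrow> {vs ! i, vs ! j} \<in> pairs (set vs) \<longleftrightarrow> i \<noteq> j"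
  using distinct_vs nth_mem[of i vs] nth_mem[of j vs]
  by (force simp: pairs_def doubleton_eq_iff nth_eq_iff_index_eq)

lemma cost2_eq_cost:
  assumes P: "\<And>i j. i < n \<Longrightarrow> j < n \<Longrightarrow> together P {vs ! i, vs ! j} \<longleftrightarrow> f i = f j"
  shows "cost2 f = 2 * cost Ep Em P"
proof -
  let ?A = "{e \<in> Ep. \<not> together P e}" and ?B = "{e \<in> Em. together P e}"
  have "pairs (set vs) \<subseteq> Pow (set vs)" by (auto simp: pairs_def)
  then have fin: "finite (Ep \<union> Em)" unfolding edges(1) by (metis List.finite_set finite_Pow_iff finite_subset)
  have "cost2 f = (\<Sum>i<n. card {j \<in> {..<n}. edge i j \<noteq> (f i = f j)})"
    unfolding cost2_def mis_def by (simp only: sum_of_bool_card[OF finite_lessThan])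
  also have "\<dots> = card (SIGMA i:{..<n}. {j \<in> {..<n}. edge i j \<noteq> (f i = f j)})"
    by (simp add: card_SigmaI)
  also have "(SIGMA i:{..<n}. {j \<in> {..<n}. edge i j \<noteq> (f i = f j)})
      = {(i, j). i < n \<and> j < n \<and> {vs ! i, vs ! j} \<in> ?A \<union> ?B}"
  proof -
    have "edge i j \<noteq> (f i = f j) \<longleftrightarrow> {vs ! i, vs ! j} \<in> ?A \<union> ?B" if "i < n" "j < n" for i j
      using P[OF that] nth_pairs[OF that] edges by (auto simp: edge_def)
    then show ?thesis by blast
  qed
  also have "card \<dots> = 2 * card (?A \<union> ?B)"
    using edges(1) by (intro card_index_pairs distinct_vs) auto
  also have "card (?A \<union> ?B) = card ?A + card ?B"
    using fin edges(2) by (intro card_Un_disjoint) auto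
  finally show ?thesis by (simp add: cost_def)
qed

abbreviation fibres :: "(nat \<Rightarrow> nat) \<Rightarrow> 'a set set" where
  "fibres f \<equiv> {{vs ! j | j. j < n \<and> f j = f i} | i. i < n}"

lemma cost2_fibres: "cost2 f = 2 * cost Ep Em (fibres f)"
  by (rule cost2_eq_cost[OF together_fibres[OF distinct_vs]])

text \<open>Labellings and partitions translate into each other at the same cost, up to the factor
  2, so an optimal partition yields a labelling that no other labelling beats.\<close>

lemma optimal_exists: obtains f where "optimal f" "cost2 f = 2 * opt V Ep Em"
proof -
  let ?P = "{\<C>. partition_on V \<C>}"
  have "?P \<subseteq> Pow (Pow V)" using partition_onD1 by fastforce
  moreover have "finite V" using set_vs by auto
  ultimately have fin: "finite (cost Ep Em ` ?P)" using finite_subset by blast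
  have fib: "fibres g \<in> ?P" for g :: "nat \<Rightarrow> nat" using partition_on_fibres[OF distinct_vs, of g] set_vs by simp
  then have "opt V Ep Em \<in> cost Ep Em ` ?P" unfolding opt_def using fin by (intro Min_in) auto
  then obtain P where P: "partition_on V P" "cost Ep Em P = opt V Ep Em" by auto
  then have "partition_on (set vs) P" using set_vs by simp
  from partition_on_labelling[OF this] obtain f :: "nat \<Rightarrow> nat"
    where "\<forall>i<n. \<forall>j<n. together P {vs ! i, vs ! j} \<longleftrightarrow> f i = f j" ..
  then have f: "together P {vs ! i, vs ! j} \<longleftrightarrow> f i = f j" if "i < n" "j < n" for i j
    using that by simp
  have cost: "cost2 f = 2 * opt V Ep Em" using cost2_eq_cost[OF f] P by simp
  moreover have "cost2 f \<le> cost2 g" for g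
    unfolding cost cost2_fibres[of g] opt_def using fin fib[of g] by (intro mult_le_mono2 Min_le) auto
  ultimately show ?thesis using that by (auto simp: optimal_def)
qed

text \<open>The labelling is a parameter because array 1 of the final state is known to agree with
  \<open>label\<close> only below \<open>n\<close>.\<close>

definition atoms :: "(nat \<Rightarrow> nat) \<Rightarrow> 'a set set" where
  "atoms lab = {{vs ! i | i. i < n \<and> lab i = lab j} | j. j < n \<and> lab j \<noteq> 0}"

definition adms :: "nat \<Rightarrow> 'a set set" where
  "adms M = {{vs ! i, vs ! j} | i j. i < j \<and> j < n \<and> admissible M i j}"

context
  fixes lab :: "nat \<Rightarrow> nat" and M L :: nat
  assumes lab: "\<forall>i<n. lab i = label i" and L_le_M: "64 * L \<le> M" and L: "2 \<le> L"
begin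

lemma Union_atoms: "i < n \<Longrightarrow> vs ! i \<in> \<Union>(atoms lab) \<longleftrightarrow> covered i"
proof -
  assume i: "i < n"
  obtain f where f: "optimal f" using optimal_exists by blast
  have "vs ! i \<in> \<Union>(atoms lab) \<longleftrightarrow> lab i \<noteq> 0"
    using i distinct_vs by (auto simp: atoms_def nth_eq_iff_index_eq)
  then show ?thesis using label_nonzero_iff[OF f i] lab i by simp
qed

lemma atoms_nth:
  assumes "optimal f" "i < n" "j < n"
  shows "(\<exists>K\<in>atoms lab. {vs ! i, vs ! j} \<subseteq> K) \<longleftrightarrow> covered i \<and> covered j \<and> f i = f j"
proof -
  have "(\<exists>K\<in>atoms lab. {vs ! i, vs ! j} \<subseteq> K) \<longleftrightarrow> lab i \<noteq> 0 \<and> lab i = lab j"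
  proof
    assume "lab i \<noteq> 0 \<and> lab i = lab j"
    then have "{vs ! l | l. l < n \<and> lab l = lab i} \<in> atoms lab"
      "{vs ! i, vs ! j} \<subseteq> {vs ! l | l. l < n \<and> lab l = lab i}"
      using assms by (auto simp: atoms_def)
    then show "\<exists>K\<in>atoms lab. {vs ! i, vs ! j} \<subseteq> K" by blast
  qed (use assms distinct_vs in \<open>auto simp: atoms_def nth_eq_iff_index_eq\<close>)
  also have "\<dots> \<longleftrightarrow> covered i \<and> covered j \<and> f i = f j"
    using label_nonzero_iff[OF assms(1)] label_eq_iff[OF assms(1)] lab assms by metis
  finally show ?thesis .
qed

lemma adms_nth:
  assumes "i < n" "j < n" "i \<noteq> j"
  shows "{vs ! i, vs ! j} \<in> adms M \<longleftrightarrow> admissible M i j"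
proof -
  have sym: "admissible M i j \<longleftrightarrow> admissible M j i" for i j by (auto simp: admissible_def)
  have "{vs ! i, vs ! j} \<in> adms M \<longleftrightarrow> (\<exists>k l. k < l \<and> l < n \<and> admissible M k l \<and> (i = k \<and> j = l \<or> i = l \<and> j = k))"
    unfolding adms_def mem_Collect_eq doubleton_eq_iff
    using assms distinct_vs nth_eq_iff_index_eq by (smt (verit) order.strict_trans)
  then show ?thesis using assms sym by (metis linorder_neqE_nat)
qed

lemma preclustered_atoms: "preclustered V (atoms lab) (adms M)"
  unfolding preclustered_def
proof (intro conjI allI impI ballI)
  show "K \<subseteq> V" if "K \<in> atoms lab" for K using that set_vs by (auto simp: atoms_def)
  show "disjoint (atoms lab)"
    using distinct_vs by (auto simp: atoms_def disjoint_def nth_eq_iff_index_eq)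
  show "adms M \<subseteq> pairs V"
  proof
    fix e assume "e \<in> adms M"
    then obtain i j where "e = {vs ! i, vs ! j}" "i < j" "j < n" by (auto simp: adms_def)
    then show "e \<in> pairs V" using nth_pairs[of i j] set_vs by simp
  qed
  fix u v assume "{u, v} \<in> adms M"
  then obtain i j where ij: "{u, v} = {vs ! i, vs ! j}" "i < j" "j < n" "admissible M i j"
    by (auto simp: adms_def)
  then have "\<not> covered i \<or> \<not> covered j" by (auto simp: admissible_def)
  then have "vs ! i \<notin> \<Union>(atoms lab) \<or> vs ! j \<notin> \<Union>(atoms lab)" using Union_atoms ij by auto
  then show "u \<notin> \<Union>(atoms lab) \<or> v \<notin> \<Union>(atoms lab)" using ij(1) by (metis doubleton_eq_iff)
qed

lemma good_clustering_exists:
  "\<exists>\<C>. good_clustering V (atoms lab) (adms M) \<C> \<and>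
     (L - 1) * cost Ep Em \<C> \<le> (L - 1) * opt V Ep Em + 64 * opt V Ep Em"
proof -
  obtain f where f: "optimal f" "cost2 f = 2 * opt V Ep Em" by (rule optimal_exists)
  obtain g where g: "\<And>u v. u < n \<Longrightarrow> v < n \<Longrightarrow>
      g u = g v \<longleftrightarrow> u = v \<or> f u = f v \<and> \<not> removed L f u \<and> \<not> removed L f v"
    and cost: "(L - 1) * cost2 g \<le> (L - 1) * cost2 f + 64 * cost2 f"
    using pruned_clustering[where f = f and L = L] by (metis lessThan_iff)
  have pair: "\<exists>i j. e = {vs ! i, vs ! j} \<and> i < n \<and> j < n \<and> i \<noteq> j" if "e \<in> pairs V" for e
    using that set_vs unfolding pairs_def by (smt (verit) in_set_conv_nth mem_Collect_eq)
  \<comment> \<open>An uncovered vertex that survives pruning must belong to a light cluster, since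
    all other clusters lose their uncovered vertices.\<close>
  have near: "near M i j"
    if "i < n" "j < n" "f i = f j" "\<not> removed L f i" "\<not> removed L f j" "\<not> covered i" for i j
  proof -
    have light: "light_cluster L f i" "\<not> heavy L f i" using that by (auto simp: removed_def split: if_splits)
    then have "light_cluster L f j" using cls_eq[of f i j] that(3) by (simp add: light_cluster_def)
    then have "\<not> heavy L f j" using that by (simp add: removed_def)
    with light that show ?thesis using near_of_light_cluster[OF f(1), of i j L M] L_le_M by simp
  qed
  have "good_clustering V (atoms lab) (adms M) (fibres g)"
    unfolding good_clustering_def
  proof (intro conjI ballI)
    show "partition_on V (fibres g)" using partition_on_fibres[OF distinct_vs, of g] set_vs by simp
  next
    fix e assume "e \<in> atomic_pairs V (atoms lab)"
    then obtain i j where ij: "e = {vs ! i, vs ! j}" "i < n" "j < n" "\<exists>K\<in>atoms lab. e \<subseteq> K"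
      unfolding atomic_pairs_def using pair by blast
    then have "covered i" "covered j" "f i = f j" using atoms_nth[OF f(1)] by auto
    then have "g i = g j" using g covered_not_removed[OF f(1)] L ij by blast
    then show "together (fibres g) e" using together_fibres[OF distinct_vs ij(2,3), where f = g] ij(1) by simp
  next
    fix e assume e: "e \<in> nonadmissible_pairs V (atoms lab) (adms M)"
    then have eV: "e \<in> pairs V" by (simp add: nonadmissible_pairs_def)
    then obtain i j where ij: "e = {vs ! i, vs ! j}" "i < n" "j < n" "i \<noteq> j" using pair by blast
    from e eV ij have notin: "\<not> (covered i \<and> covered j \<and> f i = f j)" "\<not> admissible M i j"
      using atoms_nth[OF f(1) ij(2,3)] adms_nth[OF ij(2,3,4)]
      by (auto simp: nonadmissible_pairs_def atomic_pairs_def)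
    show "\<not> together (fibres g) e"
    proof
      assume "together (fibres g) e"
      then have "g i = g j" using together_fibres[OF distinct_vs ij(2,3), where f = g] ij(1) by simp
      \<comment> \<open>Being in one cluster without being atomic, the pair has an uncovered end,
        from which \<open>near\<close> makes it admissible.\<close>
      then have "f i = f j" "\<not> removed L f i" "\<not> removed L f j" using g ij by auto
      then show False using notin near[of i j] near[of j i] ij by (auto simp: admissible_def)
    qed
  qed
  moreover have "(L - 1) * cost Ep Em (fibres g) \<le> (L - 1) * opt V Ep Em + 64 * opt V Ep Em"
  proof -
    have "2 * ((L - 1) * cost Ep Em (fibres g)) \<le> 2 * ((L - 1) * opt V Ep Em + 64 * opt V Ep Em)"
      using cost unfolding cost2_fibres[of g] f(2) by (simp add: algebra_simps)
    then show ?thesis by simp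
  qed
  ultimately show ?thesis by blast
qed

text \<open>Each admissible pair is charged to an uncovered end. The constant is 2 * 36865 * 2, the
  last factor because \<open>cost2\<close> is twice the cost.\<close>

lemma card_adms: "card (adms M) \<le> 147460 * M ^ 4 * opt V Ep Em"
proof -
  obtain f where f: "optimal f" "cost2 f = 2 * opt V Ep Em" by (rule optimal_exists)
  let ?S = "SIGMA i:{i \<in> {..<n}. \<not> covered i}. {j \<in> {..<n}. near M i j}"
  have "adms M \<subseteq> (\<lambda>(i, j). {vs ! i, vs ! j}) ` ?S"
  proof
    fix e assume "e \<in> adms M"
    then obtain i j where ij: "e = {vs ! i, vs ! j}" "i < j" "j < n" "admissible M i j"
      by (auto simp: adms_def)
    then have "(i, j) \<in> ?S \<or> (j, i) \<in> ?S" by (auto simp: admissible_def)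
    moreover have "e = {vs ! j, vs ! i}" using ij(1) by auto
    ultimately show "e \<in> (\<lambda>(i, j). {vs ! i, vs ! j}) ` ?S" using ij(1) by (auto intro: rev_image_eqI)
  qed
  then have "card (adms M) \<le> card ?S" by (intro surj_card_le) auto
  also have "\<dots> = (\<Sum>i\<in>{i \<in> {..<n}. \<not> covered i}. card {j \<in> {..<n}. near M i j})"
    by (simp add: card_SigmaI)
  also have "\<dots> \<le> (\<Sum>i\<in>{i \<in> {..<n}. \<not> covered i}. 2 * M ^ 4 * card (nb i))"
    by (intro sum_mono card_near_le) auto
  also have "\<dots> = 2 * M ^ 4 * (\<Sum>i\<in>{i \<in> {..<n}. \<not> covered i}. card (nb i))"
    by (rule sum_distrib_left[symmetric])
  also have "(\<Sum>i\<in>{i \<in> {..<n}. \<not> covered i}. card (nb i)) = (\<Sum>i<n. if covered i then 0 else card (nb i))"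
    by (subst sum.inter_filter) (auto intro: sum.cong)
  also have "2 * M ^ 4 * \<dots> \<le> 2 * M ^ 4 * (36865 * cost2 f)"
    by (intro mult_le_mono2 sum_uncovered_degree)
  finally show ?thesis using f(2) by simp
qed

end

end

section \<open>Choice of parameters and final bounds\<close>

theorem theorem4:
  shows "\<exists>\<delta>\<^sub>0 > 0. \<exists>A > 0. \<forall>\<delta>::real. 0 < \<delta> \<and> \<delta> < \<delta>\<^sub>0 \<longrightarrow>
    (\<exists>(alg :: com) (p :: nat poly).
      \<forall>(V :: nat set) Ep Em vs. cc_instance V Ep Em \<and> distinct vs \<and> set vs = V \<longrightarrow>
        (\<exists>t s \<K> Eadm.
          exec alg (input_state vs Ep) t s \<and> t \<le> poly p (card V) \<and>
          \<K> = output_atoms vs s \<and> Eadm = output_admissible vs s \<and>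
          preclustered V \<K> Eadm \<and>
          (\<exists>\<C>. good_clustering V \<K> Eadm \<C> \<and>
             real (cost Ep Em \<C>) \<le> (1 + \<delta>) * real (opt V Ep Em)) \<and>
          real (card Eadm) \<le> A * (real (opt V Ep Em) / \<delta> ^ 12)))"
proof (rule exI[of _ 1], rule conjI, simp, rule exI[of _ "147460 * 4224 ^ 4"], intro conjI allI impI)
  fix \<delta> :: real assume \<delta>: "0 < \<delta> \<and> \<delta> < 1"
  \<comment> \<open>\<open>L - 1\<close> is at least 64/\<delta>, so the loss of 64
    \<open>opt\<close> / (L - 1) is at most \<delta> \<open>opt\<close>; rounding still leaves L
    \<delta> at most 66. With \<open>M = 64 * L\<close> this gives 4224 = 64 * 66. The program
    depends on \<delta> only through \<open>M\<close>.\<close>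
  define L where "L = nat \<lceil>64 / \<delta>\<rceil> + 1"
  have L_ge: "64 / \<delta> \<le> real (L - 1)" unfolding L_def by (simp add: real_nat_ceiling_ge)
  have L_le: "real L * \<delta> \<le> 66"
  proof -
    have "0 < 64 / \<delta>" using \<delta> by simp
    then have "0 \<le> \<lceil>64 / \<delta>\<rceil>" by linarith
    then have "real (nat \<lceil>64 / \<delta>\<rceil>) = of_int \<lceil>64 / \<delta>\<rceil>" by (rule of_nat_nat)
    then have "real (nat \<lceil>64 / \<delta>\<rceil>) \<le> 64 / \<delta> + 1"
      using of_int_ceiling_le_add_one[of "64 / \<delta>"] by linarith
    moreover have "real L = real (nat \<lceil>64 / \<delta>\<rceil>) + 1" by (simp add: L_def)
    ultimately have "real L \<le> 64 / \<delta> + 2" by linarith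
    then have "real L * \<delta> \<le> (64 / \<delta> + 2) * \<delta>" using \<delta> by (intro mult_right_mono) auto
    also have "\<dots> \<le> 66" using \<delta> by (simp add: field_simps)
    finally show ?thesis .
  qed
  have "1 < 64 / \<delta>" using \<delta> by simp
  then have L: "2 \<le> L" using L_ge by linarith
  define M where "M = 64 * L"
  \<comment> \<open>The double negation normalises the stored entries to 0 or 1, so that array 2 has
    exactly known values.\<close>
  define alg where "alg = fill_tables (labelE 0) (notE (notE (admissibleE M 0 1)))"
  define p where "p = [:3:] + [:0, 1:] * ([:3:] + [:0, 1:] * (time (labelE 0) +
     (time (Plus (Sum 2 (Var 0)) (Var 1)) + time (notE (notE (admissibleE M 0 1)))) + [:6:]) + [:4:])"
  have "\<exists>t s \<K> Eadm. exec alg (input_state vs Ep) t s \<and> t \<le> poly p (card V) \<and>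
          \<K> = output_atoms vs s \<and> Eadm = output_admissible vs s \<and>
          preclustered V \<K> Eadm \<and>
          (\<exists>\<C>. good_clustering V \<K> Eadm \<C> \<and>
             real (cost Ep Em \<C>) \<le> (1 + \<delta>) * real (opt V Ep Em)) \<and>
          real (card Eadm) \<le> (147460 * 4224 ^ 4) * (real (opt V Ep Em) / \<delta> ^ 12)"
    if inst: "cc_instance V Ep Em \<and> distinct vs \<and> set vs = V" for V :: "nat set" and Ep Em vs
  proof -
    interpret indexed_instance V Ep Em vs using inst by unfold_locales auto
    let ?a = "snd (input_state vs Ep) 0"
    let ?a = "snd (input_state vs Ep) 0" and ?e = "notE (notE (admissibleE M 0 1))"
    have n: "card V = n" using distinct_card[OF distinct_vs] set_vs by simp
    have "\<exists>t s. exec (fill_tables (labelE 0) ?e) (fst (input_state vs Ep), snd (input_state vs Ep)) t s \<and>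
        t \<le> poly p n \<and> (\<forall>i<n. snd s 1 i = label i) \<and>
        (\<forall>i<n. \<forall>j<n. snd s 2 (i * n + j) = of_bool (admissible M i j))"
      unfolding p_def
    proof (rule fill_tables_exec)
      show "eval n ?a ?e \<rho> = of_bool (admissible M (\<rho> 0) (\<rho> 1))" if "\<rho> 0 < n" "\<rho> 1 < n" for \<rho>
        using that holds_admissibleE[of 0 1 \<rho> M] by (simp add: eval_notE_notE)
    qed (simp_all add: fst_input_state)
    then obtain t s where ts: "exec alg (input_state vs Ep) t s" "t \<le> poly p n"
      "\<And>i. i < n \<Longrightarrow> snd s 1 i = label i"
      "\<And>i j. i < n \<Longrightarrow> j < n \<Longrightarrow> snd s 2 (i * n + j) = of_bool (admissible M i j)"
      unfolding alg_def by auto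
    have ctx: "\<forall>i<n. snd s 1 i = label i" "64 * L \<le> M" "2 \<le> L"
      using ts(3) L by (simp_all add: M_def)
    let ?K = "output_atoms vs s" and ?E = "output_admissible vs s"
    have K: "atoms (snd s 1) = ?K" unfolding atoms_def output_atoms_def Let_def ..
    have E: "adms M = ?E"
    proof -
      have "admissible M i j \<longleftrightarrow> snd s 2 (i * n + j) \<noteq> 0" if "i < j" "j < n" for i j
        using ts(4)[of i j] that by simp
      then show ?thesis unfolding adms_def output_admissible_def Let_def by blast
    qed
    obtain \<C> where C: "good_clustering V ?K ?E \<C>"
      "(L - 1) * cost Ep Em \<C> \<le> (L - 1) * opt V Ep Em + 64 * opt V Ep Em"
      using good_clustering_exists[OF ctx] unfolding K E by blast
    have "real (cost Ep Em \<C>) \<le> (1 + \<delta>) * real (opt V Ep Em)"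
    proof -
      define x where "x = real (L - 1)"
      have x: "0 < x" using L by (simp add: x_def)
      have "64 \<le> x * \<delta>" using L_ge pos_divide_le_eq[of \<delta> 64 x] \<delta> by (simp only: x_def)
      then have "64 * real (opt V Ep Em) \<le> x * \<delta> * real (opt V Ep Em)"
        by (rule mult_right_mono) simp
      moreover have "x * real (cost Ep Em \<C>) \<le> x * real (opt V Ep Em) + 64 * real (opt V Ep Em)"
        using of_nat_mono[OF C(2), where ?'a = real] unfolding x_def
        by (simp only: of_nat_mult of_nat_add of_nat_numeral)
      ultimately have "x * real (cost Ep Em \<C>) \<le> x * ((1 + \<delta>) * real (opt V Ep Em))"
        by (simp add: algebra_simps)
      then show ?thesis using x by simp
    qed
    moreover have "real (card ?E) \<le> (147460 * 4224 ^ 4) * (real (opt V Ep Em) / \<delta> ^ 12)"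
    proof -
      have "real M * \<delta> \<le> 4224" using L_le by (simp add: M_def mult.commute)
      then have "(real M * \<delta>) ^ 4 \<le> 4224 ^ 4" using \<delta> by (intro power_mono) auto
      \<comment> \<open>The argument gives the exponent 4; as \<delta> < 1, the missing factor
        \<delta>^8 only weakens the bound.\<close>
      moreover have "\<delta> ^ 8 \<le> 1" using \<delta> by (intro power_le_one) auto
      ultimately have "(real M * \<delta>) ^ 4 * \<delta> ^ 8 \<le> 4224 ^ 4 * 1" using \<delta> by (intro mult_mono) auto
      moreover have "(real M * \<delta>) ^ 4 * \<delta> ^ 8 = real M ^ 4 * \<delta> ^ 12"
        by (simp add: power_mult_distrib flip: power_add)
      ultimately have "real M ^ 4 * \<delta> ^ 12 \<le> 4224 ^ 4" by simp
      then have "real M ^ 4 \<le> 4224 ^ 4 / \<delta> ^ 12" using \<delta> by (simp add: pos_le_divide_eq)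
      then have "147460 * real M ^ 4 * real (opt V Ep Em) \<le> 147460 * (4224 ^ 4 / \<delta> ^ 12) * real (opt V Ep Em)"
        by (intro mult_right_mono mult_left_mono) auto
      moreover have "real (card ?E) \<le> 147460 * real M ^ 4 * real (opt V Ep Em)"
        using of_nat_mono[OF card_adms[OF ctx], where ?'a = real] unfolding E
        by (simp only: of_nat_mult of_nat_power of_nat_numeral)
      ultimately show ?thesis by simp
    qed
    moreover have "preclustered V ?K ?E" using preclustered_atoms[OF ctx] unfolding K E .
    ultimately show ?thesis using ts(1,2) C(1) unfolding n by blast
  qed
  then show "\<exists>(alg :: com) (p :: nat poly).
      \<forall>(V :: nat set) Ep Em vs. cc_instance V Ep Em \<and> distinct vs \<and> set vs = V \<longrightarrow>
        (\<exists>t s \<K> Eadm.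
          exec alg (input_state vs Ep) t s \<and> t \<le> poly p (card V) \<and>
          \<K> = output_atoms vs s \<and> Eadm = output_admissible vs s \<and>
          preclustered V \<K> Eadm \<and>
          (\<exists>\<C>. good_clustering V \<K> Eadm \<C> \<and>
             real (cost Ep Em \<C>) \<le> (1 + \<delta>) * real (opt V Ep Em)) \<and>
          real (card Eadm) \<le> (147460 * 4224 ^ 4) * (real (opt V Ep Em) / \<delta> ^ 12))"
    by blast
qed simp

end
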